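(* Let $T>0$, $n\in\mathbb{N}$, $h=T/n$. Let $0\neq u_h\in S_h^0(0,T)$ be arbitrary but fixed, with cosine Fourier coefficients $\overline{u}_k$, $k\in\mathbb{N}_0$. Define $w_h:=Q_h\mathcal{H}_T^{-1}u_h\in S_h^0(0,T)$ as the unique solution of the variational formulation $$\langle w_h,v_h\rangle_{L^2(0,T)}=\langle \mathcal{H}_T^{-1}u_h,v_h\rangle_{L^2(0,T)}\quad\text{for all } v_h\in S_h^0(0,T).$$ Then the inf-sup condition $$c_S(u_h)\,\|u_h\|_{L^2(0,T)}\le\frac{\langle u_h,\mathcal{H}_Tw_h\rangle_{L^2(0,T)}}{\|w_h\|_{L^2(0,T)}}$$ holds true with $$c_S(u_h):=\frac{2\sqrt3}{\pi^2}\,\frac{16n^2-8n(2M+1)}{(4n-(2M+1))^2},$$ where $$M:=\min\Big\{m\in\mathbb{N}_0:\ \|u_h\|_{L^2(0,T)}^2\le\frac T2\,\frac{\pi^2}{3}\sum_{k=0}^m\overline{u}_k^2\Big\}\le n-1 .$$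
   Context: For $T>0$ and $n\in\mathbb{N}=\{1,2,\dots\}$ let $h=T/n$ and $t_i=ih$ for $i=0,\dots,n$. $S_h^0(0,T)\subset L^2(0,T)$ is the space of functions that are constant on each element $(t_{i-1},t_i)$, $i=1,\dots,n$. Modified Hilbert transformation: every $v\in L^2(0,T)$ has the expansion $v(t)=\sum_{k=0}^\infty v_k\sin\big((\frac\pi2+k\pi)\frac tT\big)$ with $v_k=\frac2T\int_0^Tv(t)\sin\big((\frac\pi2+k\pi)\frac tT\big)\,dt$, and $\mathcal{H}_T:L^2(0,T)\to L^2(0,T)$ is defined by $(\mathcal{H}_Tv)(t)=\sum_{k=0}^\infty v_k\cos\big((\frac\pi2+k\pi)\frac tT\big)$. Every $w\in L^2(0,T)$ also has the expansion $w(t)=\sum_{k=0}^\infty\overline{w}_k\cos\big((\frac\pi2+k\pi)\frac tT\big)$ with cosine Fourier coefficients $\overline{w}_k=\frac2T\int_0^Tw(t)\cos\big((\frac\pi2+k\pi)\frac tT\big)\,dt$, and the inverse of $\mathcal{H}_T$ is $(\mathcal{H}_T^{-1}w)(t)=\sum_{k=0}^\infty\overline{w}_k\sin\big((\frac\pi2+k\pi)\frac tT\big)$. $Q_h:L^2(0,T)\to S_h^0(0,T)$ denotes the $L^2(0,T)$-orthogonal projection. *)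

theory Defs
  imports "HOL-Analysis.Analysis"
begin

text \<open>Elements of the real space \<open>L\<^sup>2(0,T)\<close> are represented by functions; equality in
  \<open>L\<^sup>2(0,T)\<close> is equality almost everywhere.\<close>

abbreviation ivl_measure :: "real \<Rightarrow> real measure" where
  "ivl_measure T \<equiv> lebesgue_on {0<..<T}"

definition L2_space :: "real \<Rightarrow> (real \<Rightarrow> real) set" where
  "L2_space T = {v \<in> borel_measurable (ivl_measure T). integrable (ivl_measure T) (\<lambda>t. (v t)\<^sup>2)}"

definition L2_inner :: "real \<Rightarrow> (real \<Rightarrow> real) \<Rightarrow> (real \<Rightarrow> real) \<Rightarrow> real" where
  "L2_inner T v w = (LINT t|ivl_measure T. v t * w t)"

definition L2_nrm :: "real \<Rightarrow> (real \<Rightarrow> real) \<Rightarrow> real" where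
  "L2_nrm T v = sqrt (L2_inner T v v)"

definition sin_mode :: "real \<Rightarrow> nat \<Rightarrow> real \<Rightarrow> real" where
  "sin_mode T k t = sin ((pi / 2 + real k * pi) * (t / T))"

definition cos_mode :: "real \<Rightarrow> nat \<Rightarrow> real \<Rightarrow> real" where
  "cos_mode T k t = cos ((pi / 2 + real k * pi) * (t / T))"

definition sin_coeff_L2 :: "real \<Rightarrow> (real \<Rightarrow> real) \<Rightarrow> nat \<Rightarrow> real" where
  "sin_coeff_L2 T v k = 2 / T * (LINT t|ivl_measure T. v t * sin_mode T k t)"

definition cos_coeff_L2 :: "real \<Rightarrow> (real \<Rightarrow> real) \<Rightarrow> nat \<Rightarrow> real" where
  "cos_coeff_L2 T w k = 2 / T * (LINT t|ivl_measure T. w t * cos_mode T k t)"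

text \<open>The sum of a series is understood in the \<open>L\<^sup>2(0,T)\<close> norm. It is determined only almost
  everywhere, so the operators below choose a representative.\<close>

definition L2_sums :: "real \<Rightarrow> (nat \<Rightarrow> real \<Rightarrow> real) \<Rightarrow> (real \<Rightarrow> real) \<Rightarrow> bool" where
  "L2_sums T f g \<longleftrightarrow> g \<in> L2_space T \<and>
     (\<lambda>N. L2_nrm T (\<lambda>t. (\<Sum>k<N. f k t) - g t)) \<longlonglongrightarrow> 0"

definition Hilbert_T :: "real \<Rightarrow> (real \<Rightarrow> real) \<Rightarrow> real \<Rightarrow> real" where
  "Hilbert_T T v = (SOME g. L2_sums T (\<lambda>k t. sin_coeff_L2 T v k * cos_mode T k t) g)"

definition Hilbert_T_inv :: "real \<Rightarrow> (real \<Rightarrow> real) \<Rightarrow> real \<Rightarrow> real" where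
  "Hilbert_T_inv T w = (SOME g. L2_sums T (\<lambda>k t. cos_coeff_L2 T w k * sin_mode T k t) g)"

text \<open>Piecewise constant functions on the uniform mesh of size \<open>T/n\<close>, closed under changes on
  null sets.\<close>

definition S0 :: "real \<Rightarrow> nat \<Rightarrow> (real \<Rightarrow> real) set" where
  "S0 T n = {v \<in> L2_space T. \<forall>i\<in>{1..n}. \<exists>c.
     AE t in lebesgue_on {real (i - 1) * (T / real n) <..< real i * (T / real n)}. v t = c}"

definition solves_projection :: "real \<Rightarrow> nat \<Rightarrow> (real \<Rightarrow> real) \<Rightarrow> (real \<Rightarrow> real) \<Rightarrow> bool" where
  "solves_projection T n g w \<longleftrightarrow> w \<in> S0 T n \<and> (\<forall>v\<in>S0 T n. L2_inner T w v = L2_inner T g v)"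

definition Q_proj :: "real \<Rightarrow> nat \<Rightarrow> (real \<Rightarrow> real) \<Rightarrow> real \<Rightarrow> real" where
  "Q_proj T n g = (SOME w. solves_projection T n g w)"

definition cutoff_set :: "real \<Rightarrow> (real \<Rightarrow> real) \<Rightarrow> nat set" where
  "cutoff_set T u =
     {m. (L2_nrm T u)\<^sup>2 \<le> T / 2 * (pi\<^sup>2 / 3) * (\<Sum>k\<le>m. (cos_coeff_L2 T u k)\<^sup>2)}"

definition cutoff_index :: "real \<Rightarrow> (real \<Rightarrow> real) \<Rightarrow> nat" where
  "cutoff_index T u = (LEAST m. m \<in> cutoff_set T u)"

definition c_S :: "real \<Rightarrow> nat \<Rightarrow> (real \<Rightarrow> real) \<Rightarrow> real" where
  "c_S T n u = (let M = real (cutoff_index T u) in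
     2 * sqrt 3 / pi\<^sup>2 *
       ((16 * (real n)\<^sup>2 - 8 * real n * (2 * M + 1)) / (4 * real n - (2 * M + 1))\<^sup>2))"

end

theory Submission
  imports Defs
begin

text \<open>On a mesh with \<open>n\<close> elements, the modes \<open>2 n j + k\<close> and \<open>2 n j + 2 n - 1 - k\<close> coincide, up to
  sign, with mode \<open>k < n\<close> at the element midpoints. Hence for piecewise constant \<open>u\<close> the projection
  \<open>w = Q\<^sub>h H\<^sub>T\<^sup>-\<^sup>1 u\<close> is diagonal with respect to the type IV discrete cosine and sine transforms:
  its \<open>k\<close>-th discrete sine coefficient is \<open>\<mu>\<^sub>k\<close> times the \<open>k\<close>-th discrete cosine coefficient of
  \<open>u\<close>, where, with \<open>x = (2 k + 1) \<pi> / (4 n)\<close>,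
  \<open>\<mu>\<^sub>k = (\<Sum>j. sin\<^sup>2 x / (x + j \<pi>)\<^sup>2 - sin\<^sup>2 x / ((j + 1) \<pi> - x)\<^sup>2)\<close>.
  All summands are nonnegative, so \<open>\<mu>\<^sub>k\<close> is at least the summand \<open>j = 0\<close>, which is
  \<open>(sin x / x)\<^sup>2 (1 - (x / (\<pi> - x))\<^sup>2)\<close>. Since \<open>sin x / x \<ge> 2 / \<pi>\<close>, the definition of the cutoff
  index then bounds \<open>\<parallel>w\<parallel>\<close> below by \<open>c\<^sub>S(u) \<parallel>u\<parallel>\<close>; and \<open>\<langle>u, H\<^sub>T w\<rangle> = \<langle>H\<^sub>T\<^sup>-\<^sup>1 u, w\<rangle> = \<parallel>w\<parallel>\<^sup>2\<close>.\<close>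

section \<open>The space \<open>L\<^sup>2(0,T)\<close>\<close>

lemma finite_measure_ivl: "finite_measure (ivl_measure T)"
  by (rule finite_measure_lebesgue_on) auto

lemma L2_mult_integrable:
  assumes "v \<in> L2_space T" "w \<in> L2_space T"
  shows "integrable (ivl_measure T) (\<lambda>t. v t * w t)"
proof (rule Bochner_Integration.integrable_bound)
  show "integrable (ivl_measure T) (\<lambda>t. (v t)\<^sup>2 + (w t)\<^sup>2)"
    using assms by (auto simp: L2_space_def)
  show "(\<lambda>t. v t * w t) \<in> borel_measurable (ivl_measure T)"
    using assms by (auto simp: L2_space_def)
  have "\<bar>x * y\<bar> \<le> x\<^sup>2 + y\<^sup>2" for x y :: real
    using sum_squares_bound[of x y] sum_squares_bound[of x "- y"] by (simp add: abs_if)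
  then show "AE t in ivl_measure T. norm (v t * w t) \<le> norm ((v t)\<^sup>2 + (w t)\<^sup>2)"
    by auto
qed

lemma L2_add [intro]:
  assumes "v \<in> L2_space T" "w \<in> L2_space T"
  shows "(\<lambda>t. v t + w t) \<in> L2_space T"
proof -
  have "integrable (ivl_measure T) (\<lambda>t. (v t)\<^sup>2 + (w t)\<^sup>2 + 2 * (v t * w t))"
    using assms L2_mult_integrable[OF assms] by (auto simp: L2_space_def)
  then show ?thesis
    using assms by (auto simp: L2_space_def power2_sum mult.assoc)
qed

lemma L2_scale [intro]:
  assumes "v \<in> L2_space T"
  shows "(\<lambda>t. c * v t) \<in> L2_space T"
  using assms by (auto simp: L2_space_def power_mult_distrib)

lemma L2_diff [intro]:
  assumes "v \<in> L2_space T" "w \<in> L2_space T"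
  shows "(\<lambda>t. v t - w t) \<in> L2_space T"
  using L2_add[OF assms(1) L2_scale[OF assms(2), of "-1"]] by simp

lemma L2_sum [intro]:
  assumes "\<And>k. k \<in> I \<Longrightarrow> f k \<in> L2_space T"
  shows "(\<lambda>t. \<Sum>k\<in>I. f k t) \<in> L2_space T"
  using assms
proof (induction I rule: infinite_finite_induct)
  case (insert k I)
  then show ?case using L2_add[of "f k" T "\<lambda>t. \<Sum>k\<in>I. f k t"] by simp
qed (auto simp: L2_space_def)

lemma L2_bounded:
  assumes "v \<in> borel_measurable (ivl_measure T)" "\<And>t. \<bar>v t\<bar> \<le> B"
  shows "v \<in> L2_space T"
proof -
  have "integrable (ivl_measure T) (\<lambda>t. (v t)\<^sup>2)"
  proof (rule finite_measure.integrable_const_bound[OF finite_measure_ivl])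
    show "AE t in ivl_measure T. norm ((v t)\<^sup>2) \<le> B\<^sup>2"
      using assms(2) by (auto simp: abs_le_square_iff[symmetric] intro: order_trans[OF _ abs_ge_self])
  qed (use assms(1) in measurable)
  with assms show ?thesis by (simp add: L2_space_def)
qed

lemma L2_inner_commute: "L2_inner T v w = L2_inner T w v"
  by (simp add: L2_inner_def mult.commute)

lemma L2_inner_scale_left: "L2_inner T (\<lambda>t. c * v t) w = c * L2_inner T v w"
  by (simp add: L2_inner_def mult.assoc)

lemma L2_inner_diff_left:
  assumes "u \<in> L2_space T" "v \<in> L2_space T" "w \<in> L2_space T"
  shows "L2_inner T (\<lambda>t. u t - v t) w = L2_inner T u w - L2_inner T v w"
  using L2_mult_integrable[OF assms(1,3)] L2_mult_integrable[OF assms(2,3)]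
  by (simp add: L2_inner_def left_diff_distrib)

lemma L2_inner_sum_left:
  assumes "\<And>k. k \<in> I \<Longrightarrow> f k \<in> L2_space T" "w \<in> L2_space T"
  shows "L2_inner T (\<lambda>t. \<Sum>k\<in>I. f k t) w = (\<Sum>k\<in>I. L2_inner T (f k) w)"
  using L2_mult_integrable[OF assms(1) assms(2)]
  by (simp add: L2_inner_def sum_distrib_right Bochner_Integration.integral_sum)

lemma L2_inner_scale_right: "L2_inner T w (\<lambda>t. c * v t) = c * L2_inner T w v"
  by (simp add: L2_inner_scale_left L2_inner_commute[of T w])

lemma L2_inner_diff_right:
  assumes "u \<in> L2_space T" "v \<in> L2_space T" "w \<in> L2_space T"
  shows "L2_inner T w (\<lambda>t. u t - v t) = L2_inner T w u - L2_inner T w v"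
  using assms by (simp add: L2_inner_diff_left L2_inner_commute[of T w])

lemma L2_inner_sum_right:
  assumes "\<And>k. k \<in> I \<Longrightarrow> f k \<in> L2_space T" "w \<in> L2_space T"
  shows "L2_inner T w (\<lambda>t. \<Sum>k\<in>I. f k t) = (\<Sum>k\<in>I. L2_inner T w (f k))"
  using assms by (simp add: L2_inner_sum_left L2_inner_commute[of T w])

lemma L2_inner_self_nonneg: "0 \<le> L2_inner T v v"
  by (simp add: L2_inner_def)

lemma L2_nrm_nonneg [simp]: "0 \<le> L2_nrm T v"
  by (simp add: L2_nrm_def L2_inner_self_nonneg)

lemma L2_nrm_power2: "(L2_nrm T v)\<^sup>2 = L2_inner T v v"
  by (simp add: L2_nrm_def L2_inner_self_nonneg)

lemma L2_inner_cong_AE: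
  assumes "v \<in> borel_measurable (ivl_measure T)" "v' \<in> borel_measurable (ivl_measure T)"
    and "w \<in> borel_measurable (ivl_measure T)"
    and "AE t in ivl_measure T. v t = v' t"
  shows "L2_inner T v w = L2_inner T v' w"
  unfolding L2_inner_def using assms by (intro integral_cong_AE) auto

lemma L2_inner_self_eq_0_iff:
  assumes "v \<in> L2_space T"
  shows "L2_inner T v v = 0 \<longleftrightarrow> (AE t in ivl_measure T. v t = 0)"
  using integral_nonneg_eq_0_iff_AE[OF L2_mult_integrable[OF assms assms]]
  by (simp add: L2_inner_def)

section \<open>Inner product inequalities, completeness and orthogonal series\<close>

text \<open>The squared norm of \<open>v - s w\<close> is a nonnegative quadratic in
  \<open>s\<close>; its value at the minimiser gives the inequality. If \<open>w\<close> has norm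
  zero the quadratic is affine, which forces \<open>?b = 0\<close>.\<close>

lemma L2_Cauchy_Schwarz:
  assumes "v \<in> L2_space T" "w \<in> L2_space T"
  shows "\<bar>L2_inner T v w\<bar> \<le> L2_nrm T v * L2_nrm T w"
proof -
  let ?a = "L2_inner T v v" and ?b = "L2_inner T v w" and ?c = "L2_inner T w w"
  have quad: "0 \<le> ?a - 2 * s * ?b + s\<^sup>2 * ?c" for s
  proof -
    have sw: "(\<lambda>t. s * w t) \<in> L2_space T" using assms by auto
    have d: "(\<lambda>t. v t - s * w t) \<in> L2_space T" using assms sw by auto
    have "0 \<le> L2_inner T (\<lambda>t. v t - s * w t) (\<lambda>t. v t - s * w t)"
      by (rule L2_inner_self_nonneg)
    also have "\<dots> = ?a - 2 * s * ?b + s\<^sup>2 * ?c"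
      using assms sw d
      by (simp add: L2_inner_diff_left L2_inner_diff_right L2_inner_scale_left L2_inner_scale_right
          L2_inner_commute[of T w v] algebra_simps power2_eq_square)
    finally show ?thesis .
  qed
  have "?b\<^sup>2 \<le> ?a * ?c"
  proof (cases "?c = 0")
    case True
    then have "0 \<le> ?a - 2 * s * ?b" for s using quad[of s] by simp
    \<comment> \<open>If \<open>?b\<close> were nonzero, this \<open>s\<close> would give the affine
      function the value -1.\<close>
    from this[of "(?a + 1) / (2 * ?b)"] have "?b = 0" by (cases "?b = 0") auto
    then show ?thesis using True by simp
  next
    case False
    then have "?c > 0" using L2_inner_self_nonneg[of T w] by simp
    then show ?thesis using quad[of "?b / ?c"]
      by (simp add: field_simps power2_eq_square)
  qed
  then show ?thesis
    unfolding L2_nrm_def real_sqrt_mult[symmetric] using real_le_rsqrt[of "\<bar>?b\<bar>"] by simp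
qed

text \<open>By Cauchy-Schwarz, pairing with a fixed \<open>v\<close> is continuous in the norm. An
  L2 series can therefore be tested term by term, whichever representative of its sum was
  chosen.\<close>

lemma L2_sums_inner:
  assumes "L2_sums T f g" "\<And>k. f k \<in> L2_space T" "v \<in> L2_space T"
  shows "(\<lambda>k. L2_inner T (f k) v) sums L2_inner T g v"
proof -
  have g: "g \<in> L2_space T" using assms(1) by (simp add: L2_sums_def)
  have "(\<lambda>N. (\<Sum>k<N. L2_inner T (f k) v) - L2_inner T g v) \<longlonglongrightarrow> 0"
  proof (rule Lim_null_comparison)
    show "(\<lambda>N. L2_nrm T (\<lambda>t. (\<Sum>k<N. f k t) - g t) * L2_nrm T v) \<longlonglongrightarrow> 0"
      using assms(1) by (auto simp: L2_sums_def intro: tendsto_mult_left_zero)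
    have "\<bar>(\<Sum>k<N. L2_inner T (f k) v) - L2_inner T g v\<bar> \<le> L2_nrm T (\<lambda>t. (\<Sum>k<N. f k t) - g t) * L2_nrm T v" for N
    proof -
      have s: "(\<lambda>t. \<Sum>k<N. f k t) \<in> L2_space T" using assms by auto
      have "(\<Sum>k<N. L2_inner T (f k) v) - L2_inner T g v = L2_inner T (\<lambda>t. (\<Sum>k<N. f k t) - g t) v"
        using assms s g by (simp add: L2_inner_diff_left L2_inner_sum_left)
      then show ?thesis using L2_Cauchy_Schwarz[OF L2_diff[OF s g] assms(3)] by simp
    qed
    then show "\<forall>\<^sub>F N in sequentially. norm ((\<Sum>k<N. L2_inner T (f k) v) - L2_inner T g v)
        \<le> L2_nrm T (\<lambda>t. (\<Sum>k<N. f k t) - g t) * L2_nrm T v" by simp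
  qed
  then show ?thesis by (simp add: sums_def LIM_zero_iff)
qed

text \<open>Expanding the squared norm of \<open>v\<close> minus its partial orthogonal expansion
  bounds all partial sums by \<open>L2_inner T v v / c\<close>. This makes the sine and cosine
  coefficients square summable.\<close>

lemma L2_Bessel:
  assumes f: "\<And>k. f k \<in> L2_space T" and "v \<in> L2_space T" and "c > 0"
    and orth: "\<And>j k. L2_inner T (f j) (f k) = (if j = k then c else 0)"
  shows "summable (\<lambda>k. (L2_inner T v (f k) / c)\<^sup>2)"
proof (rule summableI_nonneg_bounded)
  fix N
  let ?a = "\<lambda>k. L2_inner T v (f k) / c"
  let ?s = "\<lambda>t. \<Sum>k<N. ?a k * f k t"
  have af: "(\<lambda>t. ?a k * f k t) \<in> L2_space T" for k by (rule L2_scale[OF f])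
  have s: "?s \<in> L2_space T" by (rule L2_sum[OF af])
  have sf: "L2_inner T ?s (f k) = (if k < N then c * ?a k else 0)" for k
  proof -
    have "L2_inner T ?s (f k) = (\<Sum>j<N. if j = k then c * ?a k else 0)"
      unfolding L2_inner_sum_left[OF af f] L2_inner_scale_left orth
      by (intro sum.cong) auto
    then show ?thesis by simp
  qed
  have vs: "L2_inner T v ?s = (\<Sum>k<N. c * (?a k)\<^sup>2)"
    unfolding L2_inner_sum_right[OF af assms(2)] L2_inner_scale_right
    using assms(3) by (intro sum.cong) (simp_all add: power2_eq_square)
  have ss: "L2_inner T ?s ?s = (\<Sum>k<N. c * (?a k)\<^sup>2)"
    unfolding L2_inner_sum_right[OF af s] L2_inner_scale_right sf
    by (intro sum.cong) (simp_all add: power2_eq_square)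
  have d: "(\<lambda>t. v t - ?s t) \<in> L2_space T" using s assms(2) by auto
  have "0 \<le> L2_inner T (\<lambda>t. v t - ?s t) (\<lambda>t. v t - ?s t)"
    by (rule L2_inner_self_nonneg)
  also have "\<dots> = L2_inner T v v - (\<Sum>k<N. c * (?a k)\<^sup>2)"
    unfolding L2_inner_diff_left[OF assms(2) s d] L2_inner_diff_right[OF assms(2) s assms(2)]
      L2_inner_diff_right[OF assms(2) s s] ss vs L2_inner_commute[of T ?s v] by simp
  finally show "(\<Sum>k<N. (?a k)\<^sup>2) \<le> L2_inner T v v / c"
    using assms(3) by (simp add: sum_distrib_left[symmetric] pos_le_divide_eq mult.commute)
qed simp

lemma L2_nrm_minus_commute: "L2_nrm T (\<lambda>t. v t - w t) = L2_nrm T (\<lambda>t. w t - v t)"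
  unfolding L2_nrm_def L2_inner_def by (intro arg_cong[where f=sqrt] Bochner_Integration.integral_cong)
    (auto simp: algebra_simps)

lemma nn_integral_L2:
  assumes "v \<in> L2_space T"
  shows "(\<integral>\<^sup>+t. ennreal ((v t)\<^sup>2) \<partial>ivl_measure T) = ennreal ((L2_nrm T v)\<^sup>2)"
  using assms unfolding L2_nrm_power2
  by (subst nn_integral_eq_integral) (auto simp: L2_space_def L2_inner_def power2_eq_square)

text \<open>On a finite measure an L2 Cauchy sequence is Cauchy in L1, so a subsequence converges
  almost everywhere. Fatou's lemma along it turns the Cauchy bounds into L2 bounds for the distance
  to the limit.\<close>

lemma L2_complete:
  assumes S: "\<And>N. S N \<in> L2_space T"
    and Cauchy: "\<And>e. e > 0 \<Longrightarrow> \<exists>N. \<forall>i\<ge>N. \<forall>j\<ge>N. L2_nrm T (\<lambda>t. S i t - S j t) < e"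
  shows "\<exists>g\<in>L2_space T. (\<lambda>N. L2_nrm T (\<lambda>t. S N t - g t)) \<longlonglongrightarrow> 0"
proof -
  let ?M = "ivl_measure T"
  have one: "(\<lambda>t. 1) \<in> L2_space T" by (rule L2_bounded[of _ _ 1]) auto
  have [measurable]: "S N \<in> borel_measurable ?M" for N using S by (simp add: L2_space_def)
  have int: "integrable ?M (S N)" for N
    using L2_mult_integrable[OF S one] by simp
  have "\<exists>N. \<forall>i\<ge>N. \<forall>j\<ge>N. (LINT t|?M. norm (S i t - S j t)) < e" if "e > 0" for e
  proof -
    \<comment> \<open>\<open>T\<close> is arbitrary here, so the norm of 1 may vanish; the added 1
      keeps the divisor positive.\<close>
    let ?K = "L2_nrm T (\<lambda>t. 1) + 1"
    have K: "?K > 0" using L2_nrm_nonneg[of T "\<lambda>t. 1"] by linarith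
    have "\<exists>N. \<forall>i\<ge>N. \<forall>j\<ge>N. L2_nrm T (\<lambda>t. S i t - S j t) < e / ?K"
      by (rule Cauchy) (use that K in simp)
    then obtain N where N: "\<And>i j. i \<ge> N \<Longrightarrow> j \<ge> N \<Longrightarrow> L2_nrm T (\<lambda>t. S i t - S j t) < e / ?K"
      by blast
    have "(LINT t|?M. norm (S i t - S j t)) < e" if "i \<ge> N" "j \<ge> N" for i j
    proof -
      let ?d = "\<lambda>t. S i t - S j t"
      have d: "?d \<in> L2_space T" using S by auto
      have ad: "(\<lambda>t. \<bar>?d t\<bar>) \<in> L2_space T" using d by (auto simp: L2_space_def)
      have "(LINT t|?M. norm (S i t - S j t)) = L2_inner T (\<lambda>t. \<bar>?d t\<bar>) (\<lambda>t. 1)"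
        by (simp add: L2_inner_def)
      also have "\<dots> \<le> L2_nrm T (\<lambda>t. \<bar>?d t\<bar>) * L2_nrm T (\<lambda>t. 1)"
        using L2_Cauchy_Schwarz[OF ad one] by linarith
      also have "L2_nrm T (\<lambda>t. \<bar>?d t\<bar>) = L2_nrm T ?d"
        by (simp add: L2_nrm_def L2_inner_def)
      also have "L2_nrm T ?d * L2_nrm T (\<lambda>t. 1) \<le> L2_nrm T ?d * ?K"
        by (intro mult_left_mono) auto
      also have "\<dots> < e" using N[OF that] K by (simp add: pos_less_divide_eq)
      finally show ?thesis .
    qed
    then show ?thesis by blast
  qed
  from cauchy_L1_AE_cauchy_subseq[OF int this]
  obtain r where r: "strict_mono r" and rc: "AE t in ?M. Cauchy (\<lambda>i. S (r i) t)" by blast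
  \<comment> \<open>Where the subsequence diverges the value of \<open>lim\<close> is unspecified;
    by \<open>rc\<close> this happens only on a null set.\<close>
  define g where "g t = lim (\<lambda>i. S (r i) t)" for t
  have [measurable]: "g \<in> borel_measurable ?M" unfolding g_def by measurable
  have lim: "AE t in ?M. (\<lambda>i. S (r i) t) \<longlonglongrightarrow> g t"
    using rc by eventually_elim (simp add: g_def Cauchy_convergent_iff convergent_LIMSEQ_iff)
  have key: "(\<integral>\<^sup>+t. ennreal ((S N t - g t)\<^sup>2) \<partial>?M) \<le> ennreal (e\<^sup>2)"
    if e: "e > 0" and N: "\<And>j. j \<ge> N \<Longrightarrow> L2_nrm T (\<lambda>t. S N t - S j t) < e" for N e
  proof -
    have "(\<integral>\<^sup>+t. ennreal ((S N t - g t)\<^sup>2) \<partial>?M)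
        = (\<integral>\<^sup>+t. liminf (\<lambda>i. ennreal ((S N t - S (r i) t)\<^sup>2)) \<partial>?M)"
    proof (rule nn_integral_cong_AE)
      show "AE t in ?M. ennreal ((S N t - g t)\<^sup>2) = liminf (\<lambda>i. ennreal ((S N t - S (r i) t)\<^sup>2))"
        using lim
      proof eventually_elim
        case (elim t)
        have *: "(\<lambda>i. ennreal ((S N t - S (r i) t)\<^sup>2)) \<longlonglongrightarrow> ennreal ((S N t - g t)\<^sup>2)"
          using elim by (intro tendsto_ennrealI tendsto_intros)
        show ?case by (rule lim_imp_Liminf[OF _ *, symmetric]) simp
      qed
    qed
    also have "\<dots> \<le> liminf (\<lambda>i. \<integral>\<^sup>+t. ennreal ((S N t - S (r i) t)\<^sup>2) \<partial>?M)"
      by (rule nn_integral_liminf) measurable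
    also have "\<dots> = liminf (\<lambda>i. ennreal ((L2_nrm T (\<lambda>t. S N t - S (r i) t))\<^sup>2))"
      using S by (simp add: nn_integral_L2 L2_diff)
    also have "\<dots> \<le> ennreal (e\<^sup>2)"
    proof (rule Liminf_le)
      have "L2_nrm T (\<lambda>t. S N t - S (r i) t) < e" if "i \<ge> N" for i
        using N[of "r i"] seq_suble[OF r, of i] that by simp
      then show "\<forall>\<^sub>F i in sequentially. ennreal ((L2_nrm T (\<lambda>t. S N t - S (r i) t))\<^sup>2) \<le> ennreal (e\<^sup>2)"
        by (intro eventually_sequentiallyI[of N]) (simp add: ennreal_leI power_mono less_imp_le)
    qed simp
    finally show ?thesis .
  qed
  have fin: "(\<lambda>t. S N t - g t) \<in> L2_space T"
    if "e > 0" and "\<And>j. j \<ge> N \<Longrightarrow> L2_nrm T (\<lambda>t. S N t - S j t) < e" for N e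
    using key[OF that]
    by (auto simp: L2_space_def integrable_iff_bounded intro: le_less_trans)
  obtain N0 where N0: "\<And>j. j \<ge> N0 \<Longrightarrow> L2_nrm T (\<lambda>t. S N0 t - S j t) < 1"
    using Cauchy[of 1] by auto
  \<comment> \<open>\<open>g\<close> is the difference of \<open>S N0\<close> and
    \<open>S N0 - g\<close>, and both are square integrable.\<close>
  have g: "g \<in> L2_space T"
    using L2_diff[OF S[of N0] fin[OF zero_less_one N0]] by simp
  have "(\<lambda>N. L2_nrm T (\<lambda>t. S N t - g t)) \<longlonglongrightarrow> 0"
  proof (rule LIMSEQ_I)
    fix e :: real assume "e > 0"
    then have "\<exists>N. \<forall>i\<ge>N. \<forall>j\<ge>N. L2_nrm T (\<lambda>t. S i t - S j t) < e / 2"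
      by (intro Cauchy) simp
    then obtain N where N: "\<And>i j. i \<ge> N \<Longrightarrow> j \<ge> N \<Longrightarrow> L2_nrm T (\<lambda>t. S i t - S j t) < e / 2"
      by blast
    have "norm (L2_nrm T (\<lambda>t. S i t - g t) - 0) < e" if i: "i \<ge> N" for i
    proof -
      have d: "(\<lambda>t. S i t - g t) \<in> L2_space T" using S g by auto
      have "ennreal ((L2_nrm T (\<lambda>t. S i t - g t))\<^sup>2) \<le> ennreal ((e / 2)\<^sup>2)"
        unfolding nn_integral_L2[OF d, symmetric]
        by (rule key) (use N i \<open>e > 0\<close> in auto)
      then have "(L2_nrm T (\<lambda>t. S i t - g t))\<^sup>2 \<le> (e / 2)\<^sup>2"
        by (simp add: ennreal_le_iff)
      then have "L2_nrm T (\<lambda>t. S i t - g t) \<le> e / 2"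
        using \<open>e > 0\<close> by (simp add: power2_le_iff_abs_le)
      then show ?thesis using \<open>e > 0\<close> by simp
    qed
    then show "\<exists>N. \<forall>i\<ge>N. norm (L2_nrm T (\<lambda>t. S i t - g t) - 0) < e" by blast
  qed
  with g show ?thesis by blast
qed

text \<open>Orthogonality makes the squared norm of a block of the series equal to \<open>c\<close>
  times the same block of the sum of \<open>(a k)\<^sup>2\<close>. Hence the partial sums are
  Cauchy, and completeness applies.\<close>

lemma L2_Riesz_Fischer:
  assumes f: "\<And>k. f k \<in> L2_space T" and "c > 0"
    and orth: "\<And>j k. L2_inner T (f j) (f k) = (if j = k then c else 0)"
    and "summable (\<lambda>k. (a k)\<^sup>2)"
  shows "\<exists>g. L2_sums T (\<lambda>k t. a k * f k t) g"
proof -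
  let ?S = "\<lambda>N t. \<Sum>k<N. a k * f k t"
  have af: "(\<lambda>t. a k * f k t) \<in> L2_space T" for k by (rule L2_scale[OF f])
  have S: "?S N \<in> L2_space T" for N by (rule L2_sum[OF af])
  have nrm: "(L2_nrm T (\<lambda>t. ?S j t - ?S i t))\<^sup>2 = c * (\<Sum>k\<in>{i..<j}. (a k)\<^sup>2)" if "i \<le> j" for i j
  proof -
    let ?d = "\<lambda>t. \<Sum>k\<in>{i..<j}. a k * f k t"
    have d: "?d \<in> L2_space T" by (rule L2_sum[OF af])
    have df: "L2_inner T ?d (f k) = (if k \<in> {i..<j} then c * a k else 0)" for k
    proof -
      have "L2_inner T ?d (f k) = (\<Sum>l\<in>{i..<j}. if l = k then c * a k else 0)"
        unfolding L2_inner_sum_left[OF af f] L2_inner_scale_left orth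
        by (intro sum.cong) auto
      then show ?thesis by simp
    qed
    have "(\<lambda>t. ?S j t - ?S i t) = ?d"
      using that by (intro ext) (simp add: sum_diff[symmetric] lessThan_minus_lessThan)
    then have "(L2_nrm T (\<lambda>t. ?S j t - ?S i t))\<^sup>2 = L2_inner T ?d ?d"
      by (simp only: L2_nrm_power2)
    also have "\<dots> = (\<Sum>k\<in>{i..<j}. c * (a k)\<^sup>2)"
      unfolding L2_inner_sum_right[OF af d] L2_inner_scale_right df
      by (intro sum.cong) (simp_all add: power2_eq_square)
    finally show ?thesis by (simp add: sum_distrib_left)
  qed
  have small: "\<exists>N. \<forall>i\<ge>N. \<forall>j\<ge>N. L2_nrm T (\<lambda>t. ?S i t - ?S j t) < e" if e: "e > 0" for e
  proof -
    obtain N where N: "\<And>i j. i \<ge> N \<Longrightarrow> norm (\<Sum>k\<in>{i..<j}. (a k)\<^sup>2) < e\<^sup>2 / c"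
      using assms(4) e \<open>c > 0\<close> unfolding summable_Cauchy
      by (metis divide_pos_pos zero_less_power)
    have *: "L2_nrm T (\<lambda>t. ?S j t - ?S i t) < e" if "i \<ge> N" "i \<le> j" for i j
    proof -
      have "(L2_nrm T (\<lambda>t. ?S j t - ?S i t))\<^sup>2 < e\<^sup>2"
        unfolding nrm[OF that(2)] using N[OF that(1), of j] \<open>c > 0\<close>
        by (simp add: pos_less_divide_eq mult.commute abs_of_nonneg[OF sum_nonneg])
      then show ?thesis using e by (simp add: power2_less_imp_less)
    qed
    have "L2_nrm T (\<lambda>t. ?S i t - ?S j t) < e" if "i \<ge> N" "j \<ge> N" for i j
      using *[of i j] *[of j i] that L2_nrm_minus_commute[of T "?S i" "?S j"]
      by (cases "i \<le> j") auto
    then show ?thesis by blast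
  qed
  from L2_complete[OF S small] show ?thesis by (auto simp: L2_sums_def)
qed

section \<open>Sine and cosine modes\<close>

text \<open>The endpoints form a null set, and for an integrable function the Bochner and gauge
  integrals agree, so the fundamental theorem on the closed interval carries over.\<close>

lemma LINT_ivl_FTC:
  fixes F f :: "real \<Rightarrow> real"
  assumes "a \<le> b" "\<And>t. (F has_real_derivative f t) (at t)" "continuous_on UNIV f"
  shows "integrable (lebesgue_on {a<..<b}) f" "(LINT t|lebesgue_on {a<..<b}. f t) = F b - F a"
proof -
  have "set_integrable lebesgue {a..b} f"
    using assms(3) by (intro absolutely_integrable_continuous_real) (auto intro: continuous_on_subset)
  then have "set_integrable lebesgue {a<..<b} f"
    by (rule set_integrable_subset) auto
  then show i: "integrable (lebesgue_on {a<..<b}) f"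
    by (simp add: integrable_restrict_space set_integrable_def)
  have "(f has_integral (F b - F a)) {a..b}"
    using assms(1,2) by (intro fundamental_theorem_of_calculus)
      (auto simp: has_real_derivative_iff_has_vector_derivative[symmetric] intro: has_field_derivative_at_within)
  then have "integral {a<..<b} f = F b - F a"
    by (metis integral_open_interval_real integral_unique)
  then show "(LINT t|lebesgue_on {a<..<b}. f t) = F b - F a"
    using lebesgue_integral_eq_integral[OF i] by simp
qed

lemma sin_mode_L2 [simp]: "sin_mode T k \<in> L2_space T"
  by (rule L2_bounded[of _ _ 1])
    (auto simp: sin_mode_def intro!: continuous_imp_measurable_on_sets_lebesgue continuous_intros)

lemma cos_mode_L2 [simp]: "cos_mode T k \<in> L2_space T"
  by (rule L2_bounded[of _ _ 1])
    (auto simp: cos_mode_def intro!: continuous_imp_measurable_on_sets_lebesgue continuous_intros)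

text \<open>The product formulas turn two half-integer modes \<open>j\<close> and \<open>k\<close>
  into cosines with the integer frequencies \<open>j - k\<close> and \<open>j + k + 1\<close>; only
  the first can be zero.\<close>

lemma LINT_cos_ivl:
  assumes "T > 0"
  shows "(LINT t|ivl_measure T. cos (real_of_int m * pi * (t / T))) = (if m = 0 then T else 0)"
    and "integrable (ivl_measure T) (\<lambda>t. cos (real_of_int m * pi * (t / T)))"
proof -
  let ?f = "\<lambda>t. cos (real_of_int m * pi * (t / T))"
  let ?F = "\<lambda>t. if m = 0 then t else sin (real_of_int m * pi * (t / T)) * T / (real_of_int m * pi)"
  have c: "continuous_on UNIV ?f" using assms by (intro continuous_intros) auto
  have d: "(?F has_real_derivative ?f t) (at t)" for t
    using assms by (cases "m = 0") (auto intro!: derivative_eq_intros)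
  have "sin (real_of_int m * pi) = 0" by (simp add: sin_zero_iff_int2)
  then show "(LINT t|ivl_measure T. ?f t) = (if m = 0 then T else 0)"
    "integrable (ivl_measure T) ?f"
    using LINT_ivl_FTC[OF _ d c, of 0 T] assms by auto
qed

lemma sin_mode_orthogonal:
  assumes "T > 0"
  shows "L2_inner T (sin_mode T j) (sin_mode T k) = (if j = k then T / 2 else 0)"
proof -
  have "sin_mode T j t * sin_mode T k t = (cos (real_of_int (int j - int k) * pi * (t / T))
      - cos (real_of_int (int j + int k + 1) * pi * (t / T))) / 2" for t
    unfolding sin_mode_def sin_times_sin by (simp add: algebra_simps add_divide_distrib[symmetric])
  then have "L2_inner T (sin_mode T j) (sin_mode T k)
      = (LINT t|ivl_measure T. (cos (real_of_int (int j - int k) * pi * (t / T))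
      - cos (real_of_int (int j + int k + 1) * pi * (t / T))) / 2)"
    by (simp only: L2_inner_def)
  then show ?thesis
    using LINT_cos_ivl[OF assms, of "int j - int k"] LINT_cos_ivl[OF assms, of "int j + int k + 1"]
    by (cases "j = k") (simp_all del: of_int_add of_int_diff)
qed

lemma cos_mode_orthogonal:
  assumes "T > 0"
  shows "L2_inner T (cos_mode T j) (cos_mode T k) = (if j = k then T / 2 else 0)"
proof -
  have "cos_mode T j t * cos_mode T k t = (cos (real_of_int (int j - int k) * pi * (t / T))
      + cos (real_of_int (int j + int k + 1) * pi * (t / T))) / 2" for t
    unfolding cos_mode_def cos_times_cos by (simp add: algebra_simps add_divide_distrib[symmetric])
  then have "L2_inner T (cos_mode T j) (cos_mode T k)
      = (LINT t|ivl_measure T. (cos (real_of_int (int j - int k) * pi * (t / T))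
      + cos (real_of_int (int j + int k + 1) * pi * (t / T))) / 2)"
    by (simp only: L2_inner_def)
  then show ?thesis
    using LINT_cos_ivl[OF assms, of "int j - int k"] LINT_cos_ivl[OF assms, of "int j + int k + 1"]
    by (cases "j = k") (simp_all del: of_int_add of_int_diff)
qed

section \<open>The transform, its inverse and their adjointness\<close>

lemma sin_coeff_L2_eq: "sin_coeff_L2 T v k = 2 / T * L2_inner T v (sin_mode T k)"
  by (simp add: sin_coeff_L2_def L2_inner_def)

lemma cos_coeff_L2_eq: "cos_coeff_L2 T v k = 2 / T * L2_inner T v (cos_mode T k)"
  by (simp add: cos_coeff_L2_def L2_inner_def)

text \<open>Bessel and Riesz-Fischer together show that the series converges, so the choice in
  \<open>Hilbert_T\<close> does pick a sum of it.\<close>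

lemma Hilbert_T_sums:
  assumes "T > 0" "v \<in> L2_space T"
  shows "L2_sums T (\<lambda>k t. sin_coeff_L2 T v k * cos_mode T k t) (Hilbert_T T v)"
proof -
  have "summable (\<lambda>k. (sin_coeff_L2 T v k)\<^sup>2)"
    using L2_Bessel[of "sin_mode T" T v "T / 2"] assms sin_mode_orthogonal[OF assms(1)]
    by (simp add: sin_coeff_L2_eq mult.commute)
  then have "\<exists>g. L2_sums T (\<lambda>k t. sin_coeff_L2 T v k * cos_mode T k t) g"
    using assms(1) cos_mode_orthogonal[OF assms(1)] by (intro L2_Riesz_Fischer[where c = "T / 2"]) auto
  then show ?thesis unfolding Hilbert_T_def by (rule someI_ex)
qed

lemma Hilbert_T_inv_sums:
  assumes "T > 0" "v \<in> L2_space T"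
  shows "L2_sums T (\<lambda>k t. cos_coeff_L2 T v k * sin_mode T k t) (Hilbert_T_inv T v)"
proof -
  have "summable (\<lambda>k. (cos_coeff_L2 T v k)\<^sup>2)"
    using L2_Bessel[of "cos_mode T" T v "T / 2"] assms cos_mode_orthogonal[OF assms(1)]
    by (simp add: cos_coeff_L2_eq mult.commute)
  then have "\<exists>g. L2_sums T (\<lambda>k t. cos_coeff_L2 T v k * sin_mode T k t) g"
    using assms(1) sin_mode_orthogonal[OF assms(1)] by (intro L2_Riesz_Fischer[where c = "T / 2"]) auto
  then show ?thesis unfolding Hilbert_T_inv_def by (rule someI_ex)
qed

text \<open>Tested term by term, both sides become the same series, with terms 2/T times the cosine
  product of \<open>u\<close> and the sine product of \<open>w\<close>.\<close>

lemma Hilbert_T_adjoint: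
  assumes "T > 0" "u \<in> L2_space T" "w \<in> L2_space T"
  shows "L2_inner T u (Hilbert_T T w) = L2_inner T (Hilbert_T_inv T u) w"
proof -
  have "(\<lambda>k. sin_coeff_L2 T w k * L2_inner T (cos_mode T k) u) sums L2_inner T (Hilbert_T T w) u"
    using L2_sums_inner[OF Hilbert_T_sums[OF assms(1,3)] _ assms(2)] L2_scale[OF cos_mode_L2]
    unfolding L2_inner_scale_left by blast
  moreover have "(\<lambda>k. cos_coeff_L2 T u k * L2_inner T (sin_mode T k) w) sums L2_inner T (Hilbert_T_inv T u) w"
    using L2_sums_inner[OF Hilbert_T_inv_sums[OF assms(1,2)] _ assms(3)] L2_scale[OF sin_mode_L2]
    unfolding L2_inner_scale_left by blast
  moreover have "sin_coeff_L2 T w k * L2_inner T (cos_mode T k) u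
      = cos_coeff_L2 T u k * L2_inner T (sin_mode T k) w" for k
    by (simp add: sin_coeff_L2_eq cos_coeff_L2_eq L2_inner_commute[of T _ u] L2_inner_commute[of T _ w])
  ultimately show ?thesis
    by (simp add: L2_inner_commute[of T u] sums_unique2)
qed

section \<open>Discrete transforms and aliasing\<close>

text \<open>Each term times 2 sin \<theta> is a difference of sines at consecutive even multiples of
  \<theta>, so the sum telescopes. The product form also covers sin \<theta> = 0.\<close>

lemma sum_cos_odd_multiples:
  "2 * sin \<theta> * (\<Sum>i<n. cos ((2 * real i + 1) * \<theta>)) = sin (2 * real n * \<theta>)"
proof (induction n)
  case (Suc n)
  have "\<theta> + (2 * real n + 1) * \<theta> = 2 * real (Suc n) * \<theta>" "\<theta> - (2 * real n + 1) * \<theta> = - (2 * real n * \<theta>)"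
    by (simp_all add: algebra_simps)
  then have "2 * (sin \<theta> * cos ((2 * real n + 1) * \<theta>)) = sin (2 * real (Suc n) * \<theta>) - sin (2 * real n * \<theta>)"
    unfolding sin_times_cos by (simp only: sin_minus) simp
  with Suc show ?case by (simp add: algebra_simps)
qed simp

lemma sum_cos_odd_multiples_eq:
  fixes m :: int
  assumes "\<bar>m\<bar> < 2 * int n"
  shows "(\<Sum>i<n. cos ((2 * real i + 1) * (real_of_int m * pi / (2 * real n)))) = (if m = 0 then real n else 0)"
proof (cases "m = 0")
  case False
  let ?\<theta> = "real_of_int m * pi / (2 * real n)"
  have n: "real n > 0" using assms by auto
  \<comment> \<open>A zero of the sine would make \<open>2 * int n\<close> divide the nonzero
    \<open>m\<close>, against the bound on \<open>m\<close>.\<close>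
  have "sin ?\<theta> \<noteq> 0"
  proof
    assume "sin ?\<theta> = 0"
    then obtain i :: int where "?\<theta> = of_int i * pi" using sin_zero_iff_int2 by blast
    then have "real_of_int m = real_of_int (i * (2 * int n))" using n by (simp add: field_simps)
    then have "m = i * (2 * int n)" by (simp only: of_int_eq_iff)
    then have "2 * int n dvd m" by simp
    then show False using dvd_imp_le_int[OF False] assms by fastforce
  qed
  moreover have "sin (2 * real n * ?\<theta>) = 0"
    using n by (simp add: sin_zero_iff_int2)
  ultimately show ?thesis
    using sum_cos_odd_multiples[of ?\<theta> n] False by simp
qed simp

text \<open>The phase of mode \<open>k\<close> at the midpoint of element \<open>i\<close>, with elements numbered from \<open>0\<close>. These are
  the angles of the type IV discrete cosine and sine transforms, which are symmetric in \<open>k\<close> and \<open>i\<close>.\<close>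

definition dct_angle :: "nat \<Rightarrow> nat \<Rightarrow> nat \<Rightarrow> real" where
  "dct_angle n k i = (2 * real k + 1) * (2 * real i + 1) * pi / (4 * real n)"

lemma dct_angle_commute: "dct_angle n k i = dct_angle n i k"
  by (simp add: dct_angle_def)

lemma dct_angle_diff_add:
  assumes "n > 0"
  shows "dct_angle n k i - dct_angle n l i = (2 * real i + 1) * (real_of_int (int k - int l) * pi / (2 * real n))"
    and "dct_angle n k i + dct_angle n l i = (2 * real i + 1) * (real_of_int (int k + int l + 1) * pi / (2 * real n))"
  using assms by (simp_all add: dct_angle_def field_simps)

text \<open>The product formula leaves the frequencies \<open>k - l\<close> and
  \<open>k + l + 1\<close>. Both are smaller than \<open>2 n\<close> in absolute value, and the
  second is never zero.\<close>

lemma dct_sin_orthogonal: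
  assumes "k < n" "l < n"
  shows "(\<Sum>i<n. sin (dct_angle n k i) * sin (dct_angle n l i)) = (if k = l then real n / 2 else 0)"
  using sum_cos_odd_multiples_eq[of "int k - int l" n] sum_cos_odd_multiples_eq[of "int k + int l + 1" n] assms
  by (simp add: sin_times_sin dct_angle_diff_add sum_divide_distrib[symmetric] sum_subtractf
      del: of_int_add of_int_diff)

lemma dct_cos_orthogonal:
  assumes "k < n" "l < n"
  shows "(\<Sum>i<n. cos (dct_angle n k i) * cos (dct_angle n l i)) = (if k = l then real n / 2 else 0)"
  using sum_cos_odd_multiples_eq[of "int k - int l" n] sum_cos_odd_multiples_eq[of "int k + int l + 1" n] assms
  by (simp add: cos_times_cos dct_angle_diff_add sum_divide_distrib[symmetric] sum.distrib
      del: of_int_add of_int_diff)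

text \<open>Expanding the square and summing over \<open>i\<close> first leaves only the diagonal
  terms. This serves as Parseval's identity for both the cosine and the sine matrix.\<close>

lemma sum_squares_orthogonal_rows:
  fixes A :: "nat \<Rightarrow> nat \<Rightarrow> real"
  assumes "\<And>k l. k < n \<Longrightarrow> l < n \<Longrightarrow> (\<Sum>i<n. A k i * A l i) = (if k = l then c else 0)"
  shows "(\<Sum>i<n. (\<Sum>k<n. d k * A k i)\<^sup>2) = c * (\<Sum>k<n. (d k)\<^sup>2)"
proof -
  have "(\<Sum>i<n. (\<Sum>k<n. d k * A k i)\<^sup>2) = (\<Sum>i<n. \<Sum>k<n. \<Sum>l<n. d k * d l * (A k i * A l i))"
    by (simp add: power2_eq_square sum_product mult_ac)
  also have "\<dots> = (\<Sum>k<n. \<Sum>i<n. \<Sum>l<n. d k * d l * (A k i * A l i))"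
    by (rule sum.swap)
  also have "\<dots> = (\<Sum>k<n. \<Sum>l<n. d k * d l * (\<Sum>i<n. A k i * A l i))"
    unfolding sum_distrib_left by (rule sum.cong[OF refl], rule sum.swap)
  also have "\<dots> = (\<Sum>k<n. \<Sum>l<n. if k = l then c * (d k)\<^sup>2 else 0)"
    using assms by (intro sum.cong) (auto simp: power2_eq_square)
  finally show ?thesis by (simp add: sum_distrib_left)
qed

text \<open>The unnormalised type IV transform. Indices \<open>k\<close> of \<open>n\<close> and
  above are allowed, so that aliased modes can be expressed as well.\<close>

definition dct :: "nat \<Rightarrow> (nat \<Rightarrow> real) \<Rightarrow> nat \<Rightarrow> real" where
  "dct n c k = (\<Sum>i<n. c i * cos (dct_angle n k i))"

text \<open>Symmetry of the angles turns each transform value into a combination of orthogonal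
  rows.\<close>

lemma dct_Parseval: "(\<Sum>k<n. (dct n c k)\<^sup>2) = real n / 2 * (\<Sum>i<n. (c i)\<^sup>2)"
  unfolding dct_def
  using sum_squares_orthogonal_rows[of n "\<lambda>k i. cos (dct_angle n k i)" "real n / 2" c] dct_cos_orthogonal
  by (simp add: dct_angle_commute)

lemma dct_angle_shift:
  assumes "n > 0"
  shows "dct_angle n (2 * n * j + k) i = dct_angle n k i + real (j * (2 * i + 1)) * pi"
  using assms by (simp add: dct_angle_def field_simps)

lemma dct_angle_reflect:
  assumes "k < n"
  shows "dct_angle n (2 * n - 1 - k) i = real (2 * i + 1) * pi - dct_angle n k i"
  using assms by (simp add: dct_angle_def field_simps of_nat_diff)

text \<open>Since \<open>2 * i + 1\<close> is odd, the sign depends on the block \<open>j\<close>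
  alone and not on the element \<open>i\<close>.\<close>

lemma
  shows sin_add_odd_mult_pi: "sin (x + real (j * (2 * i + 1)) * pi) = (-1) ^ j * sin x"
    and cos_add_odd_mult_pi: "cos (x + real (j * (2 * i + 1)) * pi) = (-1) ^ j * cos x"
proof -
  have "sin (real (j * (2 * i + 1)) * pi) = 0" by (rule sin_npi)
  moreover have "cos (real (j * (2 * i + 1)) * pi) = (-1) ^ j"
    unfolding cos_npi mult.commute[of j] power_mult by simp
  ultimately show "sin (x + real (j * (2 * i + 1)) * pi) = (-1) ^ j * sin x"
    "cos (x + real (j * (2 * i + 1)) * pi) = (-1) ^ j * cos x"
    by (simp_all only: sin_add cos_add) simp_all
qed

text \<open>Cosine and sine factor both pick up the sign (-1)^j, and the two signs cancel.\<close>

lemma dct_sin_shift: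
  assumes "n > 0"
  shows "dct n c (2 * n * j + k) * sin (dct_angle n (2 * n * j + k) i) = dct n c k * sin (dct_angle n k i)"
proof -
  have "dct n c (2 * n * j + k) = (-1) ^ j * dct n c k"
    unfolding dct_def dct_angle_shift[OF assms] cos_add_odd_mult_pi
    by (simp add: sum_distrib_left mult_ac)
  then show ?thesis
    unfolding dct_angle_shift[OF assms] sin_add_odd_mult_pi
    by (simp add: mult_ac power_add[symmetric] flip: power_mult_distrib)
qed

text \<open>Reflection about an odd multiple of pi negates the cosine but keeps the sine. This is
  the origin of the minus sign in \<open>alias_weight\<close>.\<close>

lemma dct_sin_reflect:
  assumes "k < n"
  shows "dct n c (2 * n - 1 - k) * sin (dct_angle n (2 * n - 1 - k) i) = - (dct n c k * sin (dct_angle n k i))"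
proof -
  have s: "sin (real (2 * i + 1) * pi - x) = sin x" for i x
    using sin_add_odd_mult_pi[of "- x" 1 i] by (simp add: add.commute)
  have c: "cos (real (2 * i + 1) * pi - x) = - cos x" for i x
    using cos_add_odd_mult_pi[of "- x" 1 i] by (simp add: add.commute)
  have "dct n c (2 * n - 1 - k) = - dct n c k"
    unfolding dct_def dct_angle_reflect[OF assms] c by (simp add: sum_negf)
  then show ?thesis unfolding dct_angle_reflect[OF assms] s by simp
qed

text \<open>Half the phase increment of mode \<open>k\<close> over one element.\<close>

definition half_angle :: "nat \<Rightarrow> nat \<Rightarrow> real" where
  "half_angle n k = (2 * real k + 1) * pi / (4 * real n)"

definition elem_sinc :: "nat \<Rightarrow> nat \<Rightarrow> real" where
  "elem_sinc n k = sin (half_angle n k) / half_angle n k"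

text \<open>The modes \<open>2 n j + k\<close> and \<open>2 n j + 2 n - 1 - k\<close> are aliases of mode \<open>k\<close> on the mesh; the squares
  arise because \<open>elem_sinc\<close> enters once in the cosine coefficient and once in the cell average.\<close>

definition alias_weight :: "nat \<Rightarrow> nat \<Rightarrow> nat \<Rightarrow> real" where
  "alias_weight n J k =
     (\<Sum>j<J. (elem_sinc n (2 * n * j + k))\<^sup>2 - (elem_sinc n (2 * n * j + (2 * n - 1 - k)))\<^sup>2)"

lemma sum_lessThan_fold:
  fixes f :: "nat \<Rightarrow> real"
  shows "(\<Sum>m<2 * n. f m) = (\<Sum>k<n. f k + f (2 * n - 1 - k))"
proof -
  have split: "{..<2 * n} = {..<n} \<union> {n..<2 * n}" by auto
  have "(\<Sum>m<2 * n. f m) = (\<Sum>k<n. f k) + (\<Sum>m=n..<2 * n. f m)"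
    unfolding split by (rule sum.union_disjoint) auto
  also have "(\<Sum>m=n..<2 * n. f m) = (\<Sum>k<n. f (2 * n - 1 - k))"
    by (rule sum.reindex_bij_witness[of _ "\<lambda>k. 2 * n - 1 - k" "\<lambda>m. 2 * n - 1 - m"]) auto
  finally show ?thesis by (simp add: sum.distrib)
qed

lemma sum_lessThan_mult:
  fixes f :: "nat \<Rightarrow> real"
  shows "(\<Sum>m<N * J. f m) = (\<Sum>j<J. \<Sum>k<N. f (N * j + k))"
proof (induction J)
  case (Suc J)
  have "(\<Sum>m<N * Suc J. f m) = (\<Sum>m<N * J. f m) + (\<Sum>m\<in>{N * J..<N * J + N}. f m)"
    by (subst sum.union_disjoint[symmetric]) (auto intro!: sum.cong)
  also have "(\<Sum>m\<in>{N * J..<N * J + N}. f m) = (\<Sum>k<N. f (N * J + k))"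
    by (rule sum.reindex_bij_witness[of _ "\<lambda>k. N * J + k" "\<lambda>m. m - N * J"]) auto
  finally show ?case using Suc by simp
qed simp

text \<open>The modes below \<open>2 n J\<close> split into \<open>J\<close> blocks of length
  \<open>2 n\<close>. Shifting moves each block to the first one, and folding it at its middle
  leaves \<open>n\<close> base modes.\<close>

lemma sum_aliases:
  assumes "n > 0"
  shows "(\<Sum>m<2 * n * J. (elem_sinc n m)\<^sup>2 * (dct n c m * sin (dct_angle n m i)))
    = (\<Sum>k<n. dct n c k * alias_weight n J k * sin (dct_angle n k i))"
proof -
  let ?g = "\<lambda>k. dct n c k * sin (dct_angle n k i)"
  have "(\<Sum>m<2 * n * J. (elem_sinc n m)\<^sup>2 * ?g m)
      = (\<Sum>j<J. \<Sum>k<2 * n. (elem_sinc n (2 * n * j + k))\<^sup>2 * ?g k)"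
    unfolding sum_lessThan_mult dct_sin_shift[OF assms] ..
  also have "\<dots> = (\<Sum>j<J. \<Sum>k<n. ((elem_sinc n (2 * n * j + k))\<^sup>2
      - (elem_sinc n (2 * n * j + (2 * n - 1 - k)))\<^sup>2) * ?g k)"
    unfolding sum_lessThan_fold
    by (intro sum.cong refl) (simp add: dct_sin_reflect[simplified] left_diff_distrib)
  also have "\<dots> = (\<Sum>k<n. alias_weight n J k * ?g k)"
    by (subst sum.swap) (simp add: alias_weight_def sum_distrib_right)
  finally show ?thesis by (simp add: mult_ac)
qed

section \<open>Lower bounds for the sinc factors and the alias weights\<close>

lemma half_angle_bounds:
  assumes "k < n"
  shows "0 < half_angle n k" "half_angle n k < pi / 2"
proof -
  show "0 < half_angle n k" using assms by (simp add: half_angle_def)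
  have "(2 * real k + 1) * pi < 2 * real n * pi"
    using assms by (intro mult_strict_right_mono) auto
  then show "half_angle n k < pi / 2" using assms by (simp add: half_angle_def field_simps)
qed

text \<open>All aliases share the value of sin^2 x, so the sign of a summand is decided by the
  denominators: x + j pi \<le> (j + 1) pi - x because x < pi/2. The bound is uniform in
  \<open>J\<close> and therefore survives the limit.\<close>

lemma alias_weight_ge:
  assumes "k < n" "J > 0"
  defines "x \<equiv> half_angle n k"
  shows "(elem_sinc n k)\<^sup>2 * (1 - (x / (pi - x))\<^sup>2) \<le> alias_weight n J k"
proof -
  have x: "0 < x" "x < pi / 2" using half_angle_bounds[OF assms(1)] by (simp_all add: x_def)
  have a1: "half_angle n (2 * n * j + k) = x + real j * pi" for j
    using assms(1) by (simp add: x_def half_angle_def field_simps)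
  have a2: "half_angle n (2 * n * j + (2 * n - 1 - k)) = real (j + 1) * pi - x" for j
    using assms(1) by (simp add: x_def half_angle_def field_simps of_nat_diff)
  have s1: "(sin (x + real j * pi))\<^sup>2 = (sin x)\<^sup>2" for j
    by (simp add: sin_add sin_npi cos_npi power_mult_distrib flip: power_mult)
  have s2: "(sin (real j * pi - x))\<^sup>2 = (sin x)\<^sup>2" for j
    by (simp add: sin_diff sin_npi cos_npi power_mult_distrib flip: power_mult)
  let ?t = "\<lambda>j. (elem_sinc n (2 * n * j + k))\<^sup>2 - (elem_sinc n (2 * n * j + (2 * n - 1 - k)))\<^sup>2"
  have t: "?t j = (sin x)\<^sup>2 / (x + real j * pi)\<^sup>2 - (sin x)\<^sup>2 / (real (j + 1) * pi - x)\<^sup>2" for j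
    unfolding elem_sinc_def a1 a2 power_divide s1 s2 ..
  have nonneg: "0 \<le> ?t j" for j
  proof -
    have "(x + real j * pi)\<^sup>2 \<le> (real (j + 1) * pi - x)\<^sup>2"
      using x by (intro power_mono) (auto simp: algebra_simps)
    moreover have "0 < x + real j * pi" using x by (intro add_pos_nonneg) auto
    ultimately show ?thesis unfolding t
      by (auto intro!: divide_left_mono mult_pos_pos simp: zero_less_power2)
  qed
  have "(elem_sinc n k)\<^sup>2 * (1 - (x / (pi - x))\<^sup>2) = ?t 0"
    unfolding t using x by (simp add: elem_sinc_def x_def[symmetric] power_divide field_simps)
  also have "\<dots> \<le> alias_weight n J k"
    unfolding alias_weight_def using assms(2) nonneg by (intro member_le_sum) auto
  finally show ?thesis .
qed

text \<open>Jordan's inequality: by concavity the sine lies above its chord on [0, pi/2], whose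
  slope is 2/pi.\<close>

lemma elem_sinc_ge:
  assumes "k < n"
  shows "2 / pi \<le> elem_sinc n k"
proof -
  let ?x = "half_angle n k"
  note x = half_angle_bounds[OF assms]
  have "concave_on {0..pi / 2} sin"
    by (rule f''_le0_imp_concave[where f' = cos and f'' = "\<lambda>t. - sin t"])
      (auto intro!: derivative_eq_intros sin_ge_zero)
  from concave_onD_Icc'[OF this, of ?x] show ?thesis
    using x by (simp add: elem_sinc_def pos_le_divide_eq)
qed

section \<open>Piecewise constant functions\<close>

text \<open>Elements are numbered from 0 to match the transform indices; \<open>cell T n i\<close>
  is element \<open>Suc i\<close> in the numbering of \<open>S0\<close>.\<close>

definition cell :: "real \<Rightarrow> nat \<Rightarrow> nat \<Rightarrow> real set" where
  "cell T n i = {real i * (T / real n)<..<real (Suc i) * (T / real n)}"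

definition cell_ind :: "real \<Rightarrow> nat \<Rightarrow> nat \<Rightarrow> real \<Rightarrow> real" where
  "cell_ind T n i = indicator (cell T n i)"

definition step_fun :: "real \<Rightarrow> nat \<Rightarrow> (nat \<Rightarrow> real) \<Rightarrow> real \<Rightarrow> real" where
  "step_fun T n c t = (\<Sum>i<n. c i * cell_ind T n i t)"

lemma cell_subset:
  assumes "T > 0" "i < n"
  shows "cell T n i \<subseteq> {0<..<T}"
proof -
  have "real (Suc i) * (T / real n) \<le> real n * (T / real n)"
    using assms by (intro mult_right_mono) auto
  then have upper: "real (Suc i) * (T / real n) \<le> T" using assms by simp
  have lower: "0 \<le> real i * (T / real n)" using assms by simp
  show ?thesis
    unfolding cell_def using order_le_less_trans[OF lower] order_less_le_trans[OF _ upper] by auto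
qed

lemma cell_measurable [simp]: "cell T n i \<in> sets lebesgue"
  by (simp add: cell_def)

text \<open>Rounding \<open>t / (T / real n)\<close> down recovers the index of the element that
  contains \<open>t\<close>.\<close>

lemma cell_disjoint:
  assumes "T > 0" "n > 0" "t \<in> cell T n i" "t \<in> cell T n j"
  shows "i = j"
proof -
  have "\<lfloor>t / (T / real n)\<rfloor> = int i" if "t \<in> cell T n i" for i
    using that assms(1,2) by (intro floor_unique) (auto simp: cell_def pos_le_divide_eq pos_divide_less_eq field_simps)
  from this[OF assms(3)] this[OF assms(4)] show ?thesis by simp
qed

lemma cell_ind_eq:
  assumes "T > 0" "n > 0" "t \<in> cell T n j"
  shows "cell_ind T n i t = (if i = j then 1 else 0)"
  using cell_disjoint[OF assms(1,2) _ assms(3), of i] assms(3)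
  by (cases "t \<in> cell T n i") (auto simp: cell_ind_def)

lemma step_fun_eq:
  assumes "T > 0" "t \<in> cell T n j" "j < n"
  shows "step_fun T n c t = c j"
proof -
  have "step_fun T n c t = (\<Sum>i<n. if i = j then c i else 0)"
    unfolding step_fun_def using assms by (intro sum.cong) (auto simp: cell_ind_eq)
  then show ?thesis using assms by simp
qed

lemma cell_ind_L2 [simp]: "cell_ind T n i \<in> L2_space T"
proof (rule L2_bounded[of _ _ 1])
  have "cell_ind T n i \<in> borel_measurable lebesgue"
    unfolding cell_ind_def by (rule borel_measurable_indicator) simp
  then show "cell_ind T n i \<in> borel_measurable (ivl_measure T)"
    by (rule measurable_restrict_space1)
qed (auto simp: cell_ind_def indicator_def)

lemma step_fun_L2 [simp]: "step_fun T n c \<in> L2_space T"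
  unfolding step_fun_def[abs_def] by (intro L2_sum L2_scale cell_ind_L2)

lemma Ball_Icc_Suc: "(\<forall>i\<in>{1..n}. P i) \<longleftrightarrow> (\<forall>i<n. P (Suc i))"
  unfolding image_Suc_lessThan[symmetric] by auto

lemma S0_iff:
  "v \<in> S0 T n \<longleftrightarrow> v \<in> L2_space T \<and> (\<forall>i<n. \<exists>c. AE t in lebesgue_on (cell T n i). v t = c)"
  unfolding S0_def Ball_Icc_Suc cell_def diff_Suc_1 by simp

lemma step_fun_S0:
  assumes "T > 0"
  shows "step_fun T n c \<in> S0 T n"
  unfolding S0_iff
proof (intro conjI allI impI exI)
  fix i assume "i < n"
  show "AE t in lebesgue_on (cell T n i). step_fun T n c t = c i"
    by (rule AE_I2) (use step_fun_eq[OF assms _ \<open>i < n\<close>] in simp)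
qed simp

text \<open>The exceptional set is covered by the finitely many mesh nodes and one null set per
  element.\<close>

lemma S0_AE_step_fun:
  assumes "T > 0" "n > 0" "v \<in> S0 T n"
  obtains c where "AE t in ivl_measure T. v t = step_fun T n c t"
proof -
  obtain c where c: "\<And>i. i < n \<Longrightarrow> AE t in lebesgue_on (cell T n i). v t = c i"
    using assms(3) unfolding S0_iff by metis
  have "AE t in lebesgue. t \<notin> (\<lambda>i. real i * (T / real n)) ` {..n}"
    by (rule AE_not_in) (intro negligible_iff_null_sets[THEN iffD1] negligible_finite finite_imageI finite_atMost)
  moreover have "AE t in lebesgue. \<forall>i\<in>{..<n}. t \<in> cell T n i \<longrightarrow> v t = c i"
    using c by (simp add: AE_ball_countable AE_restrict_space_iff)
  ultimately have "AE t in lebesgue. t \<in> {0<..<T} \<longrightarrow> v t = step_fun T n c t"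
  proof eventually_elim
    case (elim t)
    show ?case
    proof
      assume t: "t \<in> {0<..<T}"
      define h where "h = T / real n"
      have h: "h > 0" "T = real n * h" using assms by (auto simp: h_def)
      \<comment> \<open>Rounding gives a half-open element; the left endpoint is excluded afterwards
        because \<open>t\<close> is not a node.\<close>
      define i where "i = nat \<lfloor>t / h\<rfloor>"
      have "t / h \<ge> 0" using t h by auto
      then have i: "real i \<le> t / h" "t / h < real i + 1"
        unfolding i_def by linarith+
      then have i': "real i * h \<le> t" "t < real (Suc i) * h"
        using h by (auto simp: field_simps)
      have "real i < real n"
      proof -
        have "real i * h < real n * h" using i'(1) t h(2) by auto
        then show ?thesis using h(1) by simp
      qed
      then have "i < n" by simp
      moreover have "t \<noteq> real i * h" using elim(1) \<open>i < n\<close> unfolding h_def by auto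
      ultimately have "t \<in> cell T n i" using i' by (auto simp: cell_def h_def)
      then show "v t = step_fun T n c t"
        using elim(2) \<open>i < n\<close> by (simp add: step_fun_eq[OF assms(1)])
    qed
  qed
  then show thesis by (intro that[of c]) (simp add: AE_restrict_space_iff)
qed

lemma L2_inner_cell_ind:
  assumes "T > 0" "i < n"
  shows "L2_inner T (cell_ind T n i) g = (LINT t|lebesgue_on (cell T n i). g t)"
proof -
  have "L2_inner T (cell_ind T n i) g = (LINT t|ivl_measure T. (if t \<in> cell T n i then g t else 0))"
    unfolding L2_inner_def cell_ind_def
    by (intro Bochner_Integration.integral_cong) (auto simp: indicator_def)
  then show ?thesis using cell_subset[OF assms] by (simp add: integral_restrict)
qed

lemma cell_ind_orthogonal:
  assumes "T > 0" "i < n" "j < n"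
  shows "L2_inner T (cell_ind T n i) (cell_ind T n j) = (if i = j then T / real n else 0)"
proof -
  have "L2_inner T (cell_ind T n i) (cell_ind T n j)
      = (LINT t|lebesgue_on (cell T n i). (if i = j then 1 else 0))"
    unfolding L2_inner_cell_ind[OF assms(1,2)]
    using assms by (intro Bochner_Integration.integral_cong) (auto simp: cell_ind_eq)
  also have "\<dots> = (if i = j then T / real n else 0)"
    using LINT_ivl_FTC(2)[of "real i * (T / real n)" "real (Suc i) * (T / real n)" "\<lambda>t. t" "\<lambda>t. 1"] assms
    by (auto simp: cell_def divide_right_mono field_simps intro!: mult_right_mono)
  finally show ?thesis .
qed

lemma L2_inner_step_fun:
  assumes "g \<in> L2_space T"
  shows "L2_inner T (step_fun T n c) g = (\<Sum>i<n. c i * L2_inner T (cell_ind T n i) g)"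
  unfolding step_fun_def[abs_def]
  using assms by (subst L2_inner_sum_left) (auto simp: L2_inner_scale_left)

lemma L2_inner_step_fun_cell_ind:
  assumes "T > 0" "i < n"
  shows "L2_inner T (step_fun T n c) (cell_ind T n i) = T / real n * c i"
proof -
  have "L2_inner T (step_fun T n c) (cell_ind T n i) = (\<Sum>j<n. if j = i then T / real n * c i else 0)"
    unfolding L2_inner_step_fun[OF cell_ind_L2]
    using assms by (intro sum.cong) (auto simp: cell_ind_orthogonal)
  then show ?thesis using assms by simp
qed

lemma L2_nrm_step_fun:
  assumes "T > 0"
  shows "(L2_nrm T (step_fun T n c))\<^sup>2 = T / real n * (\<Sum>i<n. (c i)\<^sup>2)"
proof -
  have "(L2_nrm T (step_fun T n c))\<^sup>2 = (\<Sum>i<n. c i * L2_inner T (cell_ind T n i) (step_fun T n c))"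
    unfolding L2_nrm_power2 by (rule L2_inner_step_fun) simp
  also have "\<dots> = (\<Sum>i<n. c i * (T / real n * c i))"
    using L2_inner_step_fun_cell_ind[OF assms]
    by (intro sum.cong refl) (simp add: L2_inner_commute[of T "cell_ind _ _ _"])
  finally show ?thesis by (simp add: sum_distrib_left power2_eq_square mult_ac)
qed

section \<open>Integrals of the modes over single elements\<close>

text \<open>Writing the endpoint phases as midpoint phase plus or minus half the increment lets the
  addition theorems separate the two. The second factor, divided by the frequency, becomes
  \<open>elem_sinc\<close>.\<close>

lemma mode_frequency_midpoint:
  assumes "T > 0" "n > 0"
  shows "(pi / 2 + real k * pi) * (real (Suc i) * (T / real n) / T) = dct_angle n k i + half_angle n k"
    and "(pi / 2 + real k * pi) * (real i * (T / real n) / T) = dct_angle n k i - half_angle n k"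
  using assms by (simp_all add: dct_angle_def half_angle_def field_simps)

lemma mode_frequency:
  assumes "T > 0" "n > 0"
  shows "T / (pi / 2 + real k * pi) = T / real n / (2 * half_angle n k)"
proof -
  have "pi / 2 + real k * pi = (2 * real k + 1) * pi / 2" by (simp add: algebra_simps)
  then show ?thesis unfolding half_angle_def using assms by (simp only:) (simp add: divide_simps)
qed

lemma L2_inner_cell_ind_cos_mode:
  assumes "T > 0" "i < n"
  shows "L2_inner T (cell_ind T n i) (cos_mode T k)
    = T / real n * elem_sinc n k * cos (dct_angle n k i)"
proof -
  let ?w = "pi / 2 + real k * pi"
  have w: "?w > 0" by (simp add: add_pos_nonneg)
  have n: "n > 0" using assms by simp
  have d: "((\<lambda>t. sin (?w * (t / T)) * (T / ?w)) has_real_derivative cos_mode T k t) (at t)" for t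
    unfolding cos_mode_def using w assms by (auto intro!: derivative_eq_intros)
  have "L2_inner T (cell_ind T n i) (cos_mode T k)
      = sin (dct_angle n k i + half_angle n k) * (T / ?w) - sin (dct_angle n k i - half_angle n k) * (T / ?w)"
    unfolding L2_inner_cell_ind[OF assms] cell_def mode_frequency_midpoint[OF assms(1) n, symmetric]
    using assms by (intro LINT_ivl_FTC(2) d)
      (auto simp: cos_mode_def[abs_def] divide_right_mono intro!: mult_right_mono continuous_intros)
  also have "\<dots> = 2 * sin (half_angle n k) * cos (dct_angle n k i) * (T / ?w)"
    by (simp add: sin_add sin_diff algebra_simps)
  finally show ?thesis
    unfolding mode_frequency[OF assms(1) n] by (simp add: elem_sinc_def)
qed

lemma L2_inner_cell_ind_sin_mode:
  assumes "T > 0" "i < n"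
  shows "L2_inner T (cell_ind T n i) (sin_mode T k)
    = T / real n * elem_sinc n k * sin (dct_angle n k i)"
proof -
  let ?w = "pi / 2 + real k * pi"
  have w: "?w > 0" by (simp add: add_pos_nonneg)
  have n: "n > 0" using assms by simp
  have d: "((\<lambda>t. - cos (?w * (t / T)) * (T / ?w)) has_real_derivative sin_mode T k t) (at t)" for t
    unfolding sin_mode_def using w assms by (auto intro!: derivative_eq_intros)
  have "L2_inner T (cell_ind T n i) (sin_mode T k)
      = - cos (dct_angle n k i + half_angle n k) * (T / ?w) - - cos (dct_angle n k i - half_angle n k) * (T / ?w)"
    unfolding L2_inner_cell_ind[OF assms] cell_def mode_frequency_midpoint[OF assms(1) n, symmetric]
    using assms by (intro LINT_ivl_FTC(2) d)
      (auto simp: sin_mode_def[abs_def] divide_right_mono intro!: mult_right_mono continuous_intros)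
  also have "\<dots> = 2 * sin (half_angle n k) * sin (dct_angle n k i) * (T / ?w)"
    by (simp add: cos_add cos_diff algebra_simps)
  finally show ?thesis
    unfolding mode_frequency[OF assms(1) n] by (simp add: elem_sinc_def)
qed

lemma cos_coeff_step_fun:
  assumes "T > 0" "n > 0"
  shows "cos_coeff_L2 T (step_fun T n c) k = 2 / real n * elem_sinc n k * dct n c k"
  unfolding cos_coeff_L2_eq L2_inner_step_fun[OF cos_mode_L2] dct_def
  using assms by (simp add: L2_inner_cell_ind_cos_mode sum_distrib_left mult_ac)

lemma S0_L2: "v \<in> S0 T n \<Longrightarrow> v \<in> L2_space T"
  by (simp add: S0_iff)

lemma S0_diff:
  assumes "v \<in> S0 T n" "w \<in> S0 T n"
  shows "(\<lambda>t. v t - w t) \<in> S0 T n"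
  unfolding S0_iff
proof (intro conjI allI impI)
  show "(\<lambda>t. v t - w t) \<in> L2_space T" using assms by (auto dest: S0_L2)
  fix i assume "i < n"
  with assms obtain c d where
    "AE t in lebesgue_on (cell T n i). v t = c" "AE t in lebesgue_on (cell T n i). w t = d"
    unfolding S0_iff by blast
  then have "AE t in lebesgue_on (cell T n i). v t - w t = c - d" by eventually_elim simp
  then show "\<exists>c. AE t in lebesgue_on (cell T n i). v t - w t = c" ..
qed

text \<open>The cell indicators are orthogonal with squared norm \<open>T / real n\<close>, so the
  projection takes element averages.\<close>

lemma solves_projection_step_fun:
  assumes "T > 0" "n > 0" "g \<in> L2_space T"
  shows "solves_projection T n g
    (step_fun T n (\<lambda>i. real n / T * L2_inner T (cell_ind T n i) g))" (is "solves_projection T n g ?w")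
  unfolding solves_projection_def
proof (intro conjI ballI step_fun_S0 assms)
  fix v assume v: "v \<in> S0 T n"
  obtain c where c: "AE t in ivl_measure T. v t = step_fun T n c t"
    by (rule S0_AE_step_fun[OF assms(1,2) v])
  have eq: "L2_inner T v f = (\<Sum>i<n. c i * L2_inner T (cell_ind T n i) f)" if "f \<in> L2_space T" for f
    unfolding L2_inner_step_fun[OF that, symmetric]
    using v that c step_fun_L2[of T n c] by (intro L2_inner_cong_AE) (auto simp: L2_space_def S0_iff)
  have w: "L2_inner T (cell_ind T n i) ?w = L2_inner T (cell_ind T n i) g" if "i < n" for i
    unfolding L2_inner_commute[of T "cell_ind T n i" ?w] L2_inner_step_fun_cell_ind[OF assms(1) that]
    using assms by simp
  have "L2_inner T v ?w = L2_inner T v g"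
    unfolding eq[OF step_fun_L2] eq[OF assms(3)] by (intro sum.cong refl) (simp only: lessThan_iff w)
  then show "L2_inner T ?w v = L2_inner T g v"
    by (simp only: L2_inner_commute[of T _ v])
qed

text \<open>The difference of two solutions is an admissible test function, hence orthogonal to
  itself.\<close>

lemma solves_projection_unique:
  assumes "T > 0" "n > 0" "g \<in> L2_space T" "solves_projection T n g v" "solves_projection T n g w"
  shows "AE t in ivl_measure T. v t = w t"
proof -
  let ?d = "\<lambda>t. v t - w t"
  have vw: "v \<in> S0 T n" "w \<in> S0 T n" using assms by (auto simp: solves_projection_def)
  then have d: "?d \<in> S0 T n" by (rule S0_diff)
  have "L2_inner T ?d ?d = L2_inner T v ?d - L2_inner T w ?d"
    using vw d by (intro L2_inner_diff_left) (auto dest: S0_L2)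
  also have "\<dots> = 0" using assms(4,5) d by (simp add: solves_projection_def)
  finally have "AE t in ivl_measure T. ?d t = 0"
    using L2_inner_self_eq_0_iff[OF S0_L2[OF d]] by simp
  then show ?thesis by eventually_elim simp
qed

section \<open>The projected inverse transform\<close>

text \<open>The factor \<open>2 * T / (real n)\<^sup>2\<close> combines 2/n from the cosine
  coefficient with T/n from the element integral of the sine mode.\<close>

lemma Hilbert_T_inv_step_fun_cells:
  assumes "T > 0" "i < n"
  shows "(\<lambda>J. \<Sum>k<n. 2 * T / (real n)\<^sup>2 * dct n c k * alias_weight n J k * sin (dct_angle n k i))
    \<longlonglongrightarrow> L2_inner T (cell_ind T n i) (Hilbert_T_inv T (step_fun T n c))"
proof -
  let ?H = "Hilbert_T_inv T (step_fun T n c)"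
  have n: "n > 0" using assms by simp
  let ?f = "\<lambda>k. (elem_sinc n k)\<^sup>2 * (dct n c k * sin (dct_angle n k i))"
  have "(\<lambda>k. cos_coeff_L2 T (step_fun T n c) k * L2_inner T (sin_mode T k) (cell_ind T n i))
      sums L2_inner T ?H (cell_ind T n i)"
    using L2_sums_inner[OF Hilbert_T_inv_sums[OF assms(1) step_fun_L2] _ cell_ind_L2] L2_scale[OF sin_mode_L2]
    unfolding L2_inner_scale_left by blast
  moreover have "cos_coeff_L2 T (step_fun T n c) k * L2_inner T (sin_mode T k) (cell_ind T n i)
      = 2 * T / (real n)\<^sup>2 * ?f k" for k
    unfolding cos_coeff_step_fun[OF assms(1) n] L2_inner_commute[of T "sin_mode T k"]
      L2_inner_cell_ind_sin_mode[OF assms]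
    by (simp add: power2_eq_square)
  ultimately have "(\<lambda>N. \<Sum>k<N. 2 * T / (real n)\<^sup>2 * ?f k) \<longlonglongrightarrow> L2_inner T (cell_ind T n i) ?H"
    by (simp add: sums_def L2_inner_commute[of T "cell_ind T n i"])
  \<comment> \<open>Partial sums at multiples of \<open>2 * n\<close> consist of whole alias blocks,
    as \<open>sum_aliases\<close> demands.\<close>
  moreover have "filterlim (\<lambda>J. 2 * n * J) at_top sequentially"
    using n by (intro filterlim_subseq) (simp add: strict_mono_def)
  ultimately have "(\<lambda>J. \<Sum>k<2 * n * J. 2 * T / (real n)\<^sup>2 * ?f k) \<longlonglongrightarrow> L2_inner T (cell_ind T n i) ?H"
    by (rule filterlim_compose)
  then show ?thesis
    unfolding sum_distrib_left[symmetric] sum_aliases[OF n] by (simp add: sum_distrib_left mult_ac)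
qed

section \<open>Invariance under changes on null sets\<close>

lemma cos_coeff_cong_AE:
  assumes "u \<in> L2_space T" "v \<in> L2_space T" "AE t in ivl_measure T. u t = v t"
  shows "cos_coeff_L2 T u = cos_coeff_L2 T v"
proof
  fix k
  show "cos_coeff_L2 T u k = cos_coeff_L2 T v k"
    unfolding cos_coeff_L2_eq
    using assms cos_mode_L2[of T k] L2_inner_cong_AE[of u T v "cos_mode T k"] by (simp add: L2_space_def)
qed

lemma L2_nrm_cong_AE:
  assumes "u \<in> L2_space T" "v \<in> L2_space T" "AE t in ivl_measure T. u t = v t"
  shows "L2_nrm T u = L2_nrm T v"
proof -
  have "AE t in ivl_measure T. u t * u t = v t * v t"
    using assms(3) by eventually_elim simp
  then show ?thesis
    unfolding L2_nrm_def L2_inner_def using assms(1,2)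
    by (intro arg_cong[where f = sqrt] integral_cong_AE) (auto simp: L2_space_def)
qed

text \<open>The choice depends on its argument through the coefficients only, so the two results are
  equal as functions and not merely almost everywhere.\<close>

lemma Hilbert_T_inv_cong_AE:
  assumes "u \<in> L2_space T" "v \<in> L2_space T" "AE t in ivl_measure T. u t = v t"
  shows "Hilbert_T_inv T u = Hilbert_T_inv T v"
  using cos_coeff_cong_AE[OF assms] by (simp add: Hilbert_T_inv_def)

text \<open>Orthogonality of the sine matrix gives the norm of each truncated projection from its
  weighted transform values. A bound \<open>d\<close> that is uniform in \<open>J\<close> passes to
  the limit.\<close>

lemma projection_nrm_ge:
  assumes "T > 0" "n > 0"
    and w: "solves_projection T n (Hilbert_T_inv T (step_fun T n c)) w"
    and d: "\<And>J k. k < n \<Longrightarrow> J > 0 \<Longrightarrow> 0 \<le> d k \<and> d k \<le> alias_weight n J k"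
  shows "2 * T / (real n)\<^sup>2 * (\<Sum>k<n. (d k * dct n c k)\<^sup>2) \<le> (L2_nrm T w)\<^sup>2"
proof -
  let ?H = "Hilbert_T_inv T (step_fun T n c)"
  have H: "?H \<in> L2_space T"
    using Hilbert_T_inv_sums[OF assms(1) step_fun_L2] by (simp add: L2_sums_def)
  \<comment> \<open>\<open>b\<close> holds the element values of the projection; \<open>bJ J\<close>
    holds those obtained from the modes below \<open>2 * n * J\<close>.\<close>
  define b where "b i = real n / T * L2_inner T (cell_ind T n i) ?H" for i
  define bJ where "bJ J i = (\<Sum>k<n. 2 / real n * dct n c k * alias_weight n J k * sin (dct_angle n k i))" for J i
  have sb: "solves_projection T n ?H (step_fun T n b)"
    using solves_projection_step_fun[OF assms(1,2) H] by (simp add: b_def[abs_def])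
  have wL: "w \<in> L2_space T" using w by (auto simp: solves_projection_def dest: S0_L2)
  have "L2_nrm T w = L2_nrm T (step_fun T n b)"
    by (rule L2_nrm_cong_AE[OF wL step_fun_L2 solves_projection_unique[OF assms(1,2) H w sb]])
  then have nrm: "(L2_nrm T w)\<^sup>2 = T / real n * (\<Sum>i<n. (b i)\<^sup>2)"
    by (simp add: L2_nrm_step_fun[OF assms(1)])
  have "(\<lambda>J. bJ J i) \<longlonglongrightarrow> b i" if "i < n" for i
    using tendsto_mult_left[OF Hilbert_T_inv_step_fun_cells[OF assms(1) that, of c], of "real n / T"] assms(1,2)
    unfolding b_def bJ_def by (simp add: sum_distrib_left power2_eq_square mult_ac)
  then have lim: "(\<lambda>J. T / real n * (\<Sum>i<n. (bJ J i)\<^sup>2)) \<longlonglongrightarrow> (L2_nrm T w)\<^sup>2"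
    unfolding nrm by (intro tendsto_intros) auto
  have "2 * T / (real n)\<^sup>2 * (\<Sum>k<n. (d k * dct n c k)\<^sup>2) \<le> T / real n * (\<Sum>i<n. (bJ J i)\<^sup>2)"
    if "J > 0" for J
  proof -
    have "(\<Sum>i<n. (bJ J i)\<^sup>2) = real n / 2 * (\<Sum>k<n. (2 / real n * dct n c k * alias_weight n J k)\<^sup>2)"
      unfolding bJ_def by (rule sum_squares_orthogonal_rows) (rule dct_sin_orthogonal)
    also have "\<dots> = 2 / real n * (\<Sum>k<n. (alias_weight n J k * dct n c k)\<^sup>2)"
      using assms(2) by (simp add: sum_distrib_left power2_eq_square mult_ac)
    finally have "T / real n * (\<Sum>i<n. (bJ J i)\<^sup>2)
        = 2 * T / (real n)\<^sup>2 * (\<Sum>k<n. (alias_weight n J k * dct n c k)\<^sup>2)"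
      by (simp add: power2_eq_square)
    moreover have "(\<Sum>k<n. (d k * dct n c k)\<^sup>2) \<le> (\<Sum>k<n. (alias_weight n J k * dct n c k)\<^sup>2)"
      unfolding power_mult_distrib using d[OF _ that] by (intro sum_mono mult_right_mono power_mono) auto
    ultimately show ?thesis using assms(1) by (simp only:) (intro mult_left_mono, auto)
  qed
  then show ?thesis
    by (intro tendsto_lowerbound[OF lim]) (auto intro: eventually_sequentiallyI[of 1])
qed

section \<open>The cutoff index and the inf-sup constant\<close>

text \<open>With a = 4n and b = 2M + 1 one has x = b pi / a, so the ratio is b / (a - b), and (a -
  b)^2 - b^2 = a^2 - 2ab is the numerator in \<open>c_S\<close>. This is the form in which
  \<open>alias_weight_ge\<close> delivers its factor.\<close>

lemma c_S_eq:
  fixes u :: "real \<Rightarrow> real"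
  assumes "cutoff_index T u < n"
  defines "x \<equiv> half_angle n (cutoff_index T u)"
  shows "c_S T n u = 2 * sqrt 3 / pi\<^sup>2 * (1 - (x / (pi - x))\<^sup>2)"
proof -
  define a where "a = 4 * real n"
  define b where "b = 2 * real (cutoff_index T u) + 1"
  have ab: "0 < b" "b < a" using assms(1) by (auto simp: a_def b_def)
  have "pi - x = (a - b) * pi / a" using ab by (simp add: x_def half_angle_def a_def b_def field_simps)
  moreover have "x = b * pi / a" by (simp add: x_def half_angle_def a_def b_def)
  ultimately have "x / (pi - x) = b / (a - b)" using ab by simp
  then have "1 - (x / (pi - x))\<^sup>2 = ((a - b)\<^sup>2 - b\<^sup>2) / (a - b)\<^sup>2"
    using ab by (simp add: power_divide diff_divide_distrib)
  also have "(a - b)\<^sup>2 - b\<^sup>2 = 16 * (real n)\<^sup>2 - 8 * real n * b"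
    by (simp add: a_def power2_eq_square algebra_simps)
  finally show ?thesis by (simp add: c_S_def Let_def a_def b_def)
qed

text \<open>The map x / (pi - x) increases and stays below 1 on (0, pi/2). Thus the factor at the
  cutoff index is positive and the smallest among the retained modes.\<close>

lemma half_angle_ratio:
  assumes "k \<le> m" "m < n"
  defines "x \<equiv> half_angle n k" and "y \<equiv> half_angle n m"
  shows "0 \<le> x / (pi - x)" "x / (pi - x) \<le> y / (pi - y)" "y / (pi - y) < 1"
proof -
  have x: "0 < x" "x < pi / 2" using half_angle_bounds[of k n] assms by auto
  have y: "0 < y" "y < pi / 2" using half_angle_bounds[of m n] assms by auto
  have "x \<le> y" unfolding x_def y_def half_angle_def using assms
    by (intro divide_right_mono mult_right_mono) auto
  then show "x / (pi - x) \<le> y / (pi - y)" using x y by (intro frac_le) auto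
  show "0 \<le> x / (pi - x)" "y / (pi - y) < 1" using x y by (auto simp: divide_less_eq)
qed

lemma L2_nrm_step_fun_dct:
  assumes "T > 0" "n > 0"
  shows "(L2_nrm T (step_fun T n c))\<^sup>2 = 2 * T / (real n)\<^sup>2 * (\<Sum>k<n. (dct n c k)\<^sup>2)"
  unfolding L2_nrm_step_fun[OF assms(1)] dct_Parseval using assms by (simp add: power2_eq_square)

lemma cutoff_set_step_fun:
  assumes "T > 0" "n > 0"
  shows "m \<in> cutoff_set T (step_fun T n c) \<longleftrightarrow>
    (\<Sum>k<n. (dct n c k)\<^sup>2) \<le> pi\<^sup>2 / 3 * (\<Sum>k\<le>m. (elem_sinc n k * dct n c k)\<^sup>2)"
proof -
  let ?K = "2 * T / (real n)\<^sup>2"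
  have K: "?K > 0" using assms by simp
  have rhs: "T / 2 * (pi\<^sup>2 / 3) * (\<Sum>k\<le>m. (cos_coeff_L2 T (step_fun T n c) k)\<^sup>2)
      = ?K * (pi\<^sup>2 / 3 * (\<Sum>k\<le>m. (elem_sinc n k * dct n c k)\<^sup>2))"
    unfolding cos_coeff_step_fun[OF assms] by (simp add: sum_distrib_left power_mult_distrib power_divide mult_ac)
  show ?thesis
    unfolding cutoff_set_def mem_Collect_eq L2_nrm_step_fun_dct[OF assms] rhs by (rule mult_le_cancel_left_pos[OF K])
qed

text \<open>Since \<open>elem_sinc\<close> is at least 2/pi on the base modes, pi^2/3 times its
  square is at least 4/3, so the criterion holds mode by mode.\<close>

lemma cutoff_set_last:
  assumes "T > 0" "n > 0"
  shows "n - 1 \<in> cutoff_set T (step_fun T n c)"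
  unfolding cutoff_set_step_fun[OF assms] sum_distrib_left
proof -
  have "(dct n c k)\<^sup>2 \<le> pi\<^sup>2 / 3 * (elem_sinc n k * dct n c k)\<^sup>2" if "k < n" for k
  proof -
    have "(2 / pi)\<^sup>2 \<le> (elem_sinc n k)\<^sup>2"
      using elem_sinc_ge[OF that] by (intro power_mono) auto
    then have "1 \<le> pi\<^sup>2 / 3 * (elem_sinc n k)\<^sup>2"
      by (simp add: power_divide field_simps)
    from mult_right_mono[OF this, of "(dct n c k)\<^sup>2"] show ?thesis
      by (simp add: power_mult_distrib mult_ac)
  qed
  moreover have "{..n - 1} = {..<n}" using assms by auto
  ultimately show "(\<Sum>k<n. (dct n c k)\<^sup>2) \<le> (\<Sum>k\<le>n - 1. pi\<^sup>2 / 3 * (elem_sinc n k * dct n c k)\<^sup>2)"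
    by (auto intro: sum_mono)
qed

text \<open>Of the two sinc factors in the weight, one is bounded below by 2/pi, while the other
  belongs to the cosine coefficient and is kept for the cutoff inequality.\<close>

lemma c_S_projection_nrm:
  assumes "T > 0" "n > 0"
    and w: "solves_projection T n (Hilbert_T_inv T (step_fun T n c)) w"
  defines "U \<equiv> step_fun T n c"
  shows "cutoff_index T U \<le> n - 1" "0 < c_S T n U" "c_S T n U * L2_nrm T U \<le> L2_nrm T w"
proof -
  define M where "M = cutoff_index T U"
  have last: "n - 1 \<in> cutoff_set T U" unfolding U_def by (rule cutoff_set_last[OF assms(1,2)])
  show "cutoff_index T U \<le> n - 1" unfolding cutoff_index_def by (rule Least_le) (rule last)
  then have M: "M < n" using assms(2) by (simp add: M_def)
  have "M \<in> cutoff_set T U" unfolding M_def cutoff_index_def by (rule LeastI) (rule last)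
  then have cut: "(\<Sum>k<n. (dct n c k)\<^sup>2) \<le> pi\<^sup>2 / 3 * (\<Sum>k\<le>M. (elem_sinc n k * dct n c k)\<^sup>2)"
    unfolding U_def cutoff_set_step_fun[OF assms(1,2)] .
  let ?r = "\<lambda>k. half_angle n k / (pi - half_angle n k)"
  let ?q = "\<lambda>k. 1 - (?r k)\<^sup>2"
  let ?K = "2 * T / (real n)\<^sup>2"
  have K: "?K > 0" using assms by simp
  have q: "0 < ?q k" if "k < n" for k
  proof -
    have "(?r k)\<^sup>2 < 1\<^sup>2"
      using half_angle_ratio[of k k n] that by (intro power_strict_mono) auto
    then show ?thesis by simp
  qed
  have q_mono: "?q M \<le> ?q k" if "k \<le> M" for k
    using half_angle_ratio[OF that M] by (simp add: power_mono)
  have cS: "c_S T n U = 2 * sqrt 3 / pi\<^sup>2 * ?q M"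
    using c_S_eq M unfolding M_def by simp
  show cS_pos: "0 < c_S T n U" unfolding cS using q[OF M] by simp
  have coeff: "(2 * sqrt 3 / pi\<^sup>2)\<^sup>2 = 12 / pi ^ 4"
    by (simp add: power_divide power_mult_distrib flip: power_mult)
  have nrm: "(L2_nrm T U)\<^sup>2 = ?K * (\<Sum>k<n. (dct n c k)\<^sup>2)"
    unfolding U_def by (rule L2_nrm_step_fun_dct[OF assms(1,2)])
  have "(c_S T n U * L2_nrm T U)\<^sup>2 = 12 / pi ^ 4 * (?q M)\<^sup>2 * (?K * (\<Sum>k<n. (dct n c k)\<^sup>2))"
    unfolding cS power_mult_distrib[of _ "L2_nrm T U"] power_mult_distrib[of _ "?q M"] nrm coeff
    by (simp only: mult.assoc)
  also have "\<dots> \<le> 12 / pi ^ 4 * (?q M)\<^sup>2 * (?K * (pi\<^sup>2 / 3 * (\<Sum>k\<le>M. (elem_sinc n k * dct n c k)\<^sup>2)))"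
    using cut K by (intro mult_left_mono) auto
  \<comment> \<open>Here 12/pi^4 times pi^2/3 equals (2/pi)^2, which explains the constant 2 sqrt 3
    / pi^2.\<close>
  also have "\<dots> = ?K * (\<Sum>k\<le>M. (2 / pi * ?q M * (elem_sinc n k * dct n c k))\<^sup>2)"
    unfolding power_mult_distrib sum_distrib_left[symmetric] power_divide
    by (simp add: power2_eq_square power4_eq_xxxx)
  also have "\<dots> \<le> ?K * (\<Sum>k\<le>M. ((elem_sinc n k)\<^sup>2 * ?q k * dct n c k)\<^sup>2)"
  proof (intro mult_left_mono sum_mono)
    fix k assume "k \<in> {..M}"
    then have k: "k \<le> M" "k < n" using M by auto
    have s: "2 / pi \<le> elem_sinc n k" by (rule elem_sinc_ge[OF k(2)])
    have "2 / pi * ?q M \<le> elem_sinc n k * ?q k"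
      using s q_mono[OF k(1)] q[OF M] by (intro mult_mono) (auto intro: order_trans[OF _ s])
    then have "(2 / pi * ?q M)\<^sup>2 \<le> (elem_sinc n k * ?q k)\<^sup>2"
      using q[OF M] by (intro power_mono) auto
    then have "(2 / pi * ?q M)\<^sup>2 * (elem_sinc n k * dct n c k)\<^sup>2
        \<le> (elem_sinc n k * ?q k)\<^sup>2 * (elem_sinc n k * dct n c k)\<^sup>2"
      by (rule mult_right_mono) simp
    then show "(2 / pi * ?q M * (elem_sinc n k * dct n c k))\<^sup>2 \<le> ((elem_sinc n k)\<^sup>2 * ?q k * dct n c k)\<^sup>2"
      unfolding power_mult_distrib[symmetric] by (simp add: power2_eq_square mult_ac)
  qed (use K in simp)
  also have "\<dots> \<le> ?K * (\<Sum>k<n. ((elem_sinc n k)\<^sup>2 * ?q k * dct n c k)\<^sup>2)"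
    using M K by (intro mult_left_mono sum_mono2) auto
  also have "\<dots> \<le> (L2_nrm T w)\<^sup>2"
  \<comment> \<open>The bound \<open>d\<close> is the leading alias term, whose lower estimate holds
    for every positive \<open>J\<close>.\<close>
  proof (rule projection_nrm_ge[OF assms(1,2) w])
    fix J k :: nat assume "k < n" "J > 0"
    then show "0 \<le> (elem_sinc n k)\<^sup>2 * ?q k \<and> (elem_sinc n k)\<^sup>2 * ?q k \<le> alias_weight n J k"
      using q[of k] alias_weight_ge[of k n J] by simp
  qed
  finally show "c_S T n U * L2_nrm T U \<le> L2_nrm T w"
    by (rule power2_le_imp_le) simp
qed

theorem theorem4p6:
  fixes T :: real and n :: nat and u_h w_h :: "real \<Rightarrow> real"
  assumes "T > 0" and "n \<ge> 1"
    and "u_h \<in> S0 T n" and "\<not> (AE t in ivl_measure T. u_h t = 0)"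
    and "w_h = Q_proj T n (Hilbert_T_inv T u_h)"
  shows "solves_projection T n (Hilbert_T_inv T u_h) w_h
    \<and> (\<forall>w. solves_projection T n (Hilbert_T_inv T u_h) w \<longrightarrow> (AE t in ivl_measure T. w t = w_h t))
    \<and> cutoff_set T u_h \<noteq> {} \<and> cutoff_index T u_h \<le> n - 1
    \<and> L2_nrm T w_h > 0
    \<and> c_S T n u_h * L2_nrm T u_h \<le> L2_inner T u_h (Hilbert_T T w_h) / L2_nrm T w_h"
proof -
  have n: "n > 0" using assms(2) by simp
  have uL: "u_h \<in> L2_space T" using assms(3) by (rule S0_L2)
  obtain c where c: "AE t in ivl_measure T. u_h t = step_fun T n c t"
    by (rule S0_AE_step_fun[OF assms(1) n assms(3)])
  \<comment> \<open>Every quantity in the claim that involves \<open>u_h\<close> depends only on its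
    class modulo null sets, so the step function can take its place.\<close>
  let ?U = "step_fun T n c" and ?H = "Hilbert_T_inv T u_h"
  have H_eq: "?H = Hilbert_T_inv T ?U" by (rule Hilbert_T_inv_cong_AE[OF uL step_fun_L2 c])
  have nrm_eq: "L2_nrm T u_h = L2_nrm T ?U" by (rule L2_nrm_cong_AE[OF uL step_fun_L2 c])
  have cut_eq: "cutoff_set T u_h = cutoff_set T ?U"
    unfolding cutoff_set_def nrm_eq cos_coeff_cong_AE[OF uL step_fun_L2 c] ..
  have idx_eq: "cutoff_index T u_h = cutoff_index T ?U" unfolding cutoff_index_def cut_eq ..
  have cS_eq: "c_S T n u_h = c_S T n ?U" unfolding c_S_def idx_eq ..
  have HL: "?H \<in> L2_space T"
    using Hilbert_T_inv_sums[OF assms(1) uL] by (simp add: L2_sums_def)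
  have w: "solves_projection T n ?H w_h"
    unfolding assms(5) Q_proj_def 
    by (rule someI[of "solves_projection T n ?H", OF solves_projection_step_fun[OF assms(1) n HL]])
  have wS: "w_h \<in> S0 T n" using w by (simp add: solves_projection_def)
  note est = c_S_projection_nrm[OF assms(1) n w[unfolded H_eq], folded cS_eq idx_eq nrm_eq]
  have "0 < L2_nrm T u_h"
    using assms(4) L2_inner_self_eq_0_iff[OF uL] L2_inner_self_nonneg[of T u_h]
    by (simp add: L2_nrm_def order_less_le)
  then have w_pos: "0 < L2_nrm T w_h"
    using est(2,3) by (meson mult_pos_pos order_less_le_trans)
  \<comment> \<open>Adjointness moves the transform onto \<open>u_h\<close>; testing the projection
    with \<open>w_h\<close> itself then gives the squared norm.\<close>
  have "L2_inner T u_h (Hilbert_T T w_h) = L2_inner T w_h w_h"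
    using w wS Hilbert_T_adjoint[OF assms(1) uL S0_L2[OF wS]] by (simp add: solves_projection_def)
  then have "L2_inner T u_h (Hilbert_T T w_h) / L2_nrm T w_h = L2_nrm T w_h"
    using w_pos by (simp add: L2_nrm_power2[symmetric] power2_eq_square)
  then show ?thesis
    using w w_pos est cut_eq cutoff_set_last[OF assms(1) n, of c]
      solves_projection_unique[OF assms(1) n HL _ w] by auto
qed

end
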